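(* Let $f:\mathbb{R}^d\to\mathbb{R}$ be continuously differentiable with Lipschitz continuous gradient with constant $L_1>0$, i.e. $\|\nabla f(z_1)-\nabla f(z_2)\|_*\le L_1\|z_1-z_2\|$ for all $z_1,z_2\in\mathbb{R}^d$. Let $\mathcal{Z}=\mathcal{X}\times\mathcal{Y}\subset\mathbb{R}^n\times\mathbb{R}^m$ be nonempty, compact and convex with diameter $D_z=\sup\{\|z_1-z_2\|:z_1,z_2\in\mathcal{Z}\}$. Let $\mu>0$ and let $\sigma\ge 0$ satisfy $E_u[\|G_\mu(z;u)-F_\mu(z)\|_*^2]\le\sigma^2$ for all $z\in\mathbb{R}^d$. Suppose that for some $\rho\in[0,\frac{1}{24L_1\kappa^2})$ there is $z^*\in\mathcal{Z}$ satisfying the proximal weak Minty variational inequality: for all $z,\bar z\in\mathcal{Z}$ and all $a>0$, $$\langle P_{\mathcal{Z}}(z,a,F(\bar z)),\bar z-z^*\rangle+\frac{\rho}{2}\|P_{\mathcal{Z}}(z,a,F(\bar z))\|_*^2\ge 0.$$ Let $\{z_k\}_{k\ge0}$, $\{\hat z_k\}_{k\ge0}$ be generated by the (projected) zeroth-order extragradient algorithm ZO-EG with $h_{1,k}=h_{2,k}=h$, where $h\in\left(\sqrt{\frac{6\rho}{L_1\kappa\overline{\lambda}\underline{\lambda}}},\frac{1}{2L_1\kappa\overline{\lambda}}\right]$, $h>0$, and let $s_k=P_{\mathcal{Z}}(z_k,h,G_\mu(z_k;\hat u_k))$. Then for every number of iterations $N\ge0$, $$\frac{1}{N+1}\sum_{k=0}^{N}E_{\mathcal{U}_k}[|s_k|^2]\le\frac{2L_1\underline{\lambda}\overline{\lambda}\kappa|z_0-z^*|^2}{(L_1h^2\underline{\lambda}\overline{\lambda}\kappa-6\rho)(N+1)}+\frac{\mu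 D_z\underline{\lambda}\kappa L_1(d+3)^{3/2}}{L_1h^2\underline{\lambda}\overline{\lambda}\kappa-6\rho}+\frac{\mu^2\rho\underline{\lambda}\kappa^2L_1^2(d+3)^3}{L_1h^2\underline{\lambda}\overline{\lambda}\kappa-6\rho}+\frac{(36\rho\kappa^2\underline{\lambda}+\frac{4\underline{\lambda}}{L_1})\sigma^2}{L_1h^2\underline{\lambda}\overline{\lambda}\kappa-6\rho}+\frac{2D_z\underline{\lambda}\kappa\sigma}{L_1h^2\underline{\lambda}\overline{\lambda}\kappa-6\rho}.$$
   Context: $n,m\in\mathbb{N}$, $d=n+m$, points $z=(x,y)\in\mathbb{R}^n\times\mathbb{R}^m=\mathbb{R}^d$. $B_1\in\mathbb{R}^{n\times n}$, $B_2\in\mathbb{R}^{m\times m}$ are symmetric positive definite, $B$ is the block-diagonal matrix with blocks $B_1,B_2$; $\underline{\lambda}$, $\overline{\lambda}$ are its smallest and largest eigenvalues and $\kappa=\overline{\lambda}/\underline{\lambda}$. $\langle\cdot,\cdot\rangle$ is the Euclidean inner product, $|z|=\langle z,z\rangle^{1/2}$, $\|z\|=\langle z,Bz\rangle^{1/2}$, $\|z\|_*=\langle z,B^{-1}z\rangle^{1/2}$. $F(z)=(\nabla_x f(z),-\nabla_y f(z))$. For $\mu>0$ the Gaussian smoothing of $f$ is $f_\mu(z)=E_u[f(z+\mu u)]$ with $u\sim\mathcal{N}(0,B^{-1})$, and $F_\mu(z)=(\nabla_x f_\mu(z),-\nabla_y f_\mu(z))$. For $u=(u_1,u_2)\in\mathbb{R}^n\times\mathbb{R}^m$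 the random oracle is $G_\mu(z;u)=\frac{f(z+\mu u)-f(z)}{\mu}\,(B_1u_1,-B_2u_2)$. $\mathrm{Proj}_{\mathcal{Z}}(w)=\arg\min_{z\in\mathcal{Z}}\|z-w\|^2$, and $P_{\mathcal{Z}}(z,h,g)=\frac1h\left[z-\mathrm{Proj}_{\mathcal{Z}}(z-hg)\right]$ for $h>0$, $g\in\mathbb{R}^d$. ZO-EG (projected): given $z_0\in\mathcal{Z}$, for $k=0,1,\dots,N$: sample $\hat u_k\sim\mathcal{N}(0,B^{-1})$ and set $\hat z_k=\mathrm{Proj}_{\mathcal{Z}}(z_k-h_{1,k}G_\mu(z_k;\hat u_k))$; sample $u_k\sim\mathcal{N}(0,B^{-1})$ and set $z_{k+1}=\mathrm{Proj}_{\mathcal{Z}}(z_k-h_{2,k}G_\mu(\hat z_k;u_k))$. All sampled vectors are independent. $\mathcal{U}_k=[(u_0,\hat u_0),\dots,(u_k,\hat u_k)]$ and $E_{\mathcal{U}_k}$ is expectation over $\mathcal{U}_k$. *)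

theory Defs
  imports "HOL-Probability.Probability"
begin

definition sym_pos_def :: "real^'k^'k \<Rightarrow> bool" where
  "sym_pos_def A \<longleftrightarrow> transpose A = A \<and> (\<forall>v. v \<noteq> 0 \<longrightarrow> v \<bullet> (A *v v) > 0)"

text \<open>The block-diagonal matrix with blocks \<open>B1\<close>, \<open>B2\<close> is represented by its action on the
  product space, whose library inner product and norm are the Euclidean ones. Its inverse is
  the block-diagonal operator of the inverse blocks.\<close>

definition blockdiag :: "real^'n^'n \<Rightarrow> real^'m^'m \<Rightarrow> (real^'n) \<times> (real^'m) \<Rightarrow> (real^'n) \<times> (real^'m)" where
  "blockdiag B1 B2 z = (B1 *v fst z, B2 *v snd z)"

definition eigenvalues :: "('a::real_vector \<Rightarrow> 'a) \<Rightarrow> real set" where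
  "eigenvalues T = {l. \<exists>v. v \<noteq> 0 \<and> T v = l *\<^sub>R v}"

definition normB :: "real^'n^'n \<Rightarrow> real^'m^'m \<Rightarrow> (real^'n) \<times> (real^'m) \<Rightarrow> real" where
  "normB B1 B2 z = sqrt (z \<bullet> blockdiag B1 B2 z)"

definition dual_normB :: "real^'n^'n \<Rightarrow> real^'m^'m \<Rightarrow> (real^'n) \<times> (real^'m) \<Rightarrow> real" where
  "dual_normB B1 B2 z = sqrt (z \<bullet> blockdiag (matrix_inv B1) (matrix_inv B2) z)"

definition diameterB ::
    "real^'n^'n \<Rightarrow> real^'m^'m \<Rightarrow> ((real^'n) \<times> (real^'m)) set \<Rightarrow> real" where
  "diameterB B1 B2 Z = Sup {normB B1 B2 (z1 - z2) | z1 z2. z1 \<in> Z \<and> z2 \<in> Z}"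

definition grad :: "('a::real_inner \<Rightarrow> real) \<Rightarrow> 'a \<Rightarrow> 'a" where
  "grad f z = (THE D. GDERIV f z :> D)"

definition cont_diff :: "('a::real_inner \<Rightarrow> real) \<Rightarrow> bool" where
  "cont_diff f \<longleftrightarrow> (\<forall>z. f differentiable (at z)) \<and> continuous_on UNIV (grad f)"

text \<open>The saddle operator, with both blocks given by partial gradients.\<close>

definition saddle_op ::
    "((real^'n) \<times> (real^'m) \<Rightarrow> real) \<Rightarrow> (real^'n) \<times> (real^'m) \<Rightarrow> (real^'n) \<times> (real^'m)" where
  "saddle_op f z = (grad (\<lambda>x. f (x, snd z)) (fst z), - grad (\<lambda>y. f (fst z, y)) (snd z))"

text \<open>The Lebesgue density of the centred normal distribution whose covariance is the
  inverse of the block-diagonal matrix (so the precision matrix is the block-diagonal matrix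
  itself, with determinant \<open>det B1 * det B2\<close>).\<close>

definition gauss_density ::
    "real^'n^'n \<Rightarrow> real^'m^'m \<Rightarrow> (real^'n) \<times> (real^'m) \<Rightarrow> real" where
  "gauss_density B1 B2 u =
     sqrt (det B1 * det B2) / (2 * pi) powr (real (CARD('n) + CARD('m)) / 2)
       * exp (- (u \<bullet> blockdiag B1 B2 u) / 2)"

definition gauss_measure ::
    "real^'n^'n \<Rightarrow> real^'m^'m \<Rightarrow> ((real^'n) \<times> (real^'m)) measure" where
  "gauss_measure B1 B2 = density lborel (\<lambda>u. ennreal (gauss_density B1 B2 u))"

definition smoothing :: "real^'n^'n \<Rightarrow> real^'m^'m \<Rightarrow> real \<Rightarrow>
    ((real^'n) \<times> (real^'m) \<Rightarrow> real) \<Rightarrow> (real^'n) \<times> (real^'m) \<Rightarrow> real" where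
  "smoothing B1 B2 \<mu> f z = (LINT u|gauss_measure B1 B2. f (z + \<mu> *\<^sub>R u))"

definition zo_oracle :: "real^'n^'n \<Rightarrow> real^'m^'m \<Rightarrow> real \<Rightarrow>
    ((real^'n) \<times> (real^'m) \<Rightarrow> real) \<Rightarrow> (real^'n) \<times> (real^'m) \<Rightarrow>
    (real^'n) \<times> (real^'m) \<Rightarrow> (real^'n) \<times> (real^'m)" where
  "zo_oracle B1 B2 \<mu> f z u =
     ((f (z + \<mu> *\<^sub>R u) - f z) / \<mu>) *\<^sub>R (B1 *v fst u, - (B2 *v snd u))"

definition projB :: "real^'n^'n \<Rightarrow> real^'m^'m \<Rightarrow> ((real^'n) \<times> (real^'m)) set \<Rightarrow>
    (real^'n) \<times> (real^'m) \<Rightarrow> (real^'n) \<times> (real^'m)" where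
  "projB B1 B2 Z w = arg_min (\<lambda>z. (normB B1 B2 (z - w))\<^sup>2) (\<lambda>z. z \<in> Z)"

definition prox_residual :: "real^'n^'n \<Rightarrow> real^'m^'m \<Rightarrow> ((real^'n) \<times> (real^'m)) set \<Rightarrow>
    (real^'n) \<times> (real^'m) \<Rightarrow> real \<Rightarrow> (real^'n) \<times> (real^'m) \<Rightarrow> (real^'n) \<times> (real^'m)" where
  "prox_residual B1 B2 Z z h g = (1 / h) *\<^sub>R (z - projB B1 B2 Z (z - h *\<^sub>R g))"

text \<open>\<open>zo_eg B1 B2 \<mu> f Z h1 h2 z0 uhat u z zhat\<close>: for the given realisations \<open>uhat\<close>, \<open>u\<close> of the
  samples, \<open>z\<close> and \<open>zhat\<close> are the iterates of the projected zeroth-order extragradient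
  algorithm started at \<open>z0\<close>.\<close>

definition zo_eg :: "real^'n^'n \<Rightarrow> real^'m^'m \<Rightarrow> real \<Rightarrow>
    ((real^'n) \<times> (real^'m) \<Rightarrow> real) \<Rightarrow> ((real^'n) \<times> (real^'m)) set \<Rightarrow>
    (nat \<Rightarrow> real) \<Rightarrow> (nat \<Rightarrow> real) \<Rightarrow> (real^'n) \<times> (real^'m) \<Rightarrow>
    (nat \<Rightarrow> (real^'n) \<times> (real^'m)) \<Rightarrow> (nat \<Rightarrow> (real^'n) \<times> (real^'m)) \<Rightarrow>
    (nat \<Rightarrow> (real^'n) \<times> (real^'m)) \<Rightarrow> (nat \<Rightarrow> (real^'n) \<times> (real^'m)) \<Rightarrow> bool" where
  "zo_eg B1 B2 \<mu> f Z h1 h2 z0 uhat u z zhat \<longleftrightarrow>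
     z 0 = z0 \<and>
     (\<forall>k. zhat k = projB B1 B2 Z (z k - h1 k *\<^sub>R zo_oracle B1 B2 \<mu> f (z k) (uhat k)) \<and>
          z (Suc k) = projB B1 B2 Z (z k - h2 k *\<^sub>R zo_oracle B1 B2 \<mu> f (zhat k) (u k)))"

text \<open>Joint independence of all samples is expressed by indexing both sequences over one
  disjoint sum.\<close>

definition gaussian_samples :: "'w measure \<Rightarrow> real^'n^'n \<Rightarrow> real^'m^'m \<Rightarrow>
    (nat \<Rightarrow> 'w \<Rightarrow> (real^'n) \<times> (real^'m)) \<Rightarrow> (nat \<Rightarrow> 'w \<Rightarrow> (real^'n) \<times> (real^'m)) \<Rightarrow> bool" where
  "gaussian_samples M B1 B2 uhat u \<longleftrightarrow>
     prob_space M \<and>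
     prob_space.indep_vars M (\<lambda>_. borel) (case_sum uhat u) UNIV \<and>
     (\<forall>k. distributed M lborel (uhat k) (\<lambda>v. ennreal (gauss_density B1 B2 v)) \<and>
          distributed M lborel (u k) (\<lambda>v. ennreal (gauss_density B1 B2 v)))"

end

theory Submission
  imports Defs
begin

text \<open>
  Write \<open>z\<close>, \<open>v\<close>, \<open>z'\<close> for an iterate, the extrapolated point and the next iterate, and \<open>s\<close>, \<open>s2\<close>,
  \<open>p\<close> for the proximal residuals at \<open>z\<close> along the two estimates and along the exact operator at \<open>v\<close>.
  The identity
  \<open>|z' - z*|^2 = |z - z*|^2 - 2 h <s2, v - z*> + h^2 |s - s2|^2 - h^2 |s|^2\<close> turns the
  weak Minty inequality for \<open>p\<close> into a descent inequality: projections are nonexpansive in the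
  \<open>B\<close>-norm, so \<open>s - s2\<close>, \<open>p - s2\<close> and \<open>p - s\<close> are controlled by the estimation errors, the smoothing bias
  and the Lipschitz constant of the smoothed gradient, and the step size bound absorbs the terms in
  \<open>|s|^2\<close>. The descent inequality holds for every realisation; in expectation, independence of
  the fresh sample from the past bounds the second moments of the estimation errors by \<open>\<sigma>^2\<close>.
  The bias is at most \<open>\<mu> L1 E\<parallel>u\<parallel>\<close>, and \<open>E\<parallel>u\<parallel>\<close> is bounded without diagonalising \<open>B\<close>: scaling Lebesgue
  measure gives the moment generating function of \<open>\<parallel>u\<parallel>^2\<close>.
\<close>

subsection \<open>Extreme eigenvalues of a symmetric operator\<close>

text \<open>A step from \<open>v\<close> against \<open>S v\<close> changes the form to first order
  by \<open>- 2 * t * a\<close>, making it negative unless \<open>S v = 0\<close>. This takes the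
  place of a Lagrange multiplier argument for eigenvectors.\<close>

lemma semidefinite_null_vector:
  fixes S :: "'a::real_inner \<Rightarrow> 'a"
  assumes lin: "linear S" and sym: "\<And>x y. S x \<bullet> y = x \<bullet> S y"
    and nonneg: "\<And>x. 0 \<le> x \<bullet> S x" and null: "v \<bullet> S v = 0"
  shows "S v = 0"
proof (rule ccontr)
  assume "S v \<noteq> 0"
  define a where "a = S v \<bullet> S v"
  define b where "b = S v \<bullet> S (S v)"
  have a: "a > 0" using \<open>S v \<noteq> 0\<close> by (simp add: a_def)
  have b: "b \<ge> 0" unfolding b_def by (rule nonneg)
  have expand: "(v - t *\<^sub>R S v) \<bullet> S (v - t *\<^sub>R S v) = t\<^sup>2 * b - 2 * t * a" for t
  proof -
    have e: "S (v - t *\<^sub>R S v) = S v - t *\<^sub>R S (S v)"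
      by (simp add: linear_diff[OF lin] linear_scale[OF lin])
    have "v \<bullet> S (S v) = a" by (simp add: a_def sym[symmetric])
    then show ?thesis unfolding e
      by (simp add: inner_diff_left inner_diff_right null a_def[symmetric] b_def[symmetric]
          power2_eq_square algebra_simps)
  qed
  \<comment> \<open>Any positive \<open>t\<close> with \<open>t * b < 2 * a\<close> works; the added
    1 keeps \<open>t\<close> positive when \<open>b = 0\<close>.\<close>
  define t where "t = a / (b + 1)"
  have t: "t > 0" using a b by (simp add: t_def)
  have "t\<^sup>2 * b - 2 * t * a = t * (t * b - 2 * a)" by (simp add: power2_eq_square algebra_simps)
  moreover have "t * b \<le> a" using a b by (simp add: t_def field_simps)
  ultimately have "t\<^sup>2 * b - 2 * t * a < 0" using t a by (simp add: mult_less_0_iff)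
  then show False using nonneg[of "v - t *\<^sub>R S v"] unfolding expand by simp
qed

lemma continuous_on_quadratic_form:
  fixes T :: "'a::euclidean_space \<Rightarrow> 'a"
  assumes "linear T"
  shows "continuous_on S (\<lambda>v. v \<bullet> T v)"
  using assms by (intro continuous_intros) (simp add: linear_continuous_on linear_conv_bounded_linear)

text \<open>By compactness the form attains its maximum \<open>l\<close> on the unit sphere. Then
  \<open>l\<close> times the identity minus \<open>T\<close> is semidefinite and its form vanishes
  at the maximiser, which is therefore an eigenvector.\<close>

lemma max_rayleigh_eigenvalue:
  fixes T :: "'a::euclidean_space \<Rightarrow> 'a"
  assumes lin: "linear T" and sym: "\<And>x y. T x \<bullet> y = x \<bullet> T y"
  obtains l where "l \<in> eigenvalues T" and "\<And>v. v \<bullet> T v \<le> l * (v \<bullet> v)"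
proof -
  have "sphere (0::'a) 1 \<noteq> {}" by simp
  then obtain w where w: "w \<in> sphere 0 1" "\<And>v. v \<in> sphere 0 1 \<Longrightarrow> v \<bullet> T v \<le> w \<bullet> T w"
    using continuous_attains_sup[OF compact_sphere _ continuous_on_quadratic_form[OF lin], of 0 1]
    by blast
  define l where "l = w \<bullet> T w"
  have ww: "w \<bullet> w = 1" using w(1) by (simp add: dot_square_norm)
  have bound: "v \<bullet> T v \<le> l * (v \<bullet> v)" for v
  proof (cases "v = 0")
    case False
    define n where "n = norm v"
    have n: "n > 0" "v \<bullet> v = n\<^sup>2" using False by (simp_all add: n_def dot_square_norm)
    have "(v /\<^sub>R n) \<bullet> T (v /\<^sub>R n) \<le> l" unfolding l_def using n by (intro w(2)) (simp add: n_def)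
    then have "(v \<bullet> T v) / n\<^sup>2 \<le> l"
      by (simp add: linear_scale[OF lin] power2_eq_square divide_inverse ac_simps)
    then show ?thesis using n by (simp add: field_simps)
  qed (simp add: linear_0[OF lin])
  have "l *\<^sub>R w - T w = 0"
  proof (rule semidefinite_null_vector[where S = "\<lambda>v. l *\<^sub>R v - T v"])
    show "linear (\<lambda>v. l *\<^sub>R v - T v)"
      by (intro linear_compose_sub lin linear_scale_self)
    show "(l *\<^sub>R x - T x) \<bullet> y = x \<bullet> (l *\<^sub>R y - T y)" for x y
      by (simp add: inner_diff_left inner_diff_right sym)
    show "0 \<le> x \<bullet> (l *\<^sub>R x - T x)" for x
      using bound[of x] by (simp add: inner_diff_right)
    show "w \<bullet> (l *\<^sub>R w - T w) = 0" by (simp add: inner_diff_right ww l_def)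
  qed
  moreover have "w \<noteq> 0" using ww by auto
  ultimately have "l \<in> eigenvalues T" by (auto simp: eigenvalues_def intro!: exI[of _ w])
  with bound show thesis by (rule that[rotated])
qed

text \<open>Eigenvectors for distinct eigenvalues are orthogonal, hence independent, hence finitely
  many. Finiteness is what gives \<open>Min\<close> and \<open>Max\<close> of the spectrum their
  meaning.\<close>

lemma finite_eigenvalues:
  fixes T :: "'a::euclidean_space \<Rightarrow> 'a"
  assumes sym: "\<And>x y. T x \<bullet> y = x \<bullet> T y"
  shows "finite (eigenvalues T)"
proof -
  define e where "e l = (SOME v. v \<noteq> 0 \<and> T v = l *\<^sub>R v)" for l
  have e: "e l \<noteq> 0 \<and> T (e l) = l *\<^sub>R e l" if "l \<in> eigenvalues T" for l
    unfolding e_def using that by (intro someI_ex[of "\<lambda>v. v \<noteq> 0 \<and> T v = l *\<^sub>R v"]) (simp add: eigenvalues_def)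
  have orth: "e l \<bullet> e k = 0" if "l \<in> eigenvalues T" "k \<in> eigenvalues T" "l \<noteq> k" for l k
    using sym[of "e l" "e k"] e[OF that(1)] e[OF that(2)] that(3) by simp
  have inj: "inj_on e (eigenvalues T)"
    by (rule inj_onI) (metis e orth inner_eq_zero_iff)
  have "pairwise orthogonal (e ` eigenvalues T)"
    by (auto simp: pairwise_def orthogonal_def intro!: orth)
  then have "independent (e ` eigenvalues T)"
    using e by (intro pairwise_orthogonal_independent) auto
  then show ?thesis
    using independent_imp_finite finite_imageD[OF _ inj] by blast
qed

lemma Max_eigenvalue_bound:
  fixes T :: "'a::euclidean_space \<Rightarrow> 'a"
  assumes lin: "linear T" and sym: "\<And>x y. T x \<bullet> y = x \<bullet> T y"
  shows "v \<bullet> T v \<le> Max (eigenvalues T) * (v \<bullet> v)"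
proof -
  obtain l where "l \<in> eigenvalues T" "v \<bullet> T v \<le> l * (v \<bullet> v)"
    using max_rayleigh_eigenvalue[OF lin sym] by metis
  moreover from this have "l \<le> Max (eigenvalues T)"
    using finite_eigenvalues[OF sym] by simp
  ultimately show ?thesis by (meson inner_ge_zero mult_right_mono order_trans)
qed

lemma Min_eigenvalue_bound:
  fixes T :: "'a::euclidean_space \<Rightarrow> 'a"
  assumes lin: "linear T" and sym: "\<And>x y. T x \<bullet> y = x \<bullet> T y"
  shows "Min (eigenvalues T) * (v \<bullet> v) \<le> v \<bullet> T v" and "Min (eigenvalues T) \<in> eigenvalues T"
proof -
  \<comment> \<open>The smallest eigenvalue of \<open>T\<close> comes from the largest one of
    \<open>- T\<close>.\<close>
  obtain l where l: "l \<in> eigenvalues (\<lambda>v. - T v)" "\<And>v. v \<bullet> (- T v) \<le> l * (v \<bullet> v)"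
    using max_rayleigh_eigenvalue[of "\<lambda>v. - T v"] linear_compose_neg[OF lin] sym by auto
  then obtain e where e: "e \<noteq> 0" "- T e = l *\<^sub>R e" by (auto simp: eigenvalues_def)
  then have "T e = (- l) *\<^sub>R e" by (metis minus_minus scaleR_minus_left)
  with e have ml: "- l \<in> eigenvalues T" by (auto simp: eigenvalues_def)
  then have "Min (eigenvalues T) \<le> - l" using finite_eigenvalues[OF sym] by simp
  then have "Min (eigenvalues T) * (v \<bullet> v) \<le> - l * (v \<bullet> v)"
    by (intro mult_right_mono) auto
  also have "\<dots> \<le> v \<bullet> T v" using l(2)[of v] by simp
  finally show "Min (eigenvalues T) * (v \<bullet> v) \<le> v \<bullet> T v" .
  show "Min (eigenvalues T) \<in> eigenvalues T"
    using ml finite_eigenvalues[OF sym] by (intro Min_in) auto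
qed

subsection \<open>Norms induced by a positive definite operator\<close>

text \<open>Stated for an arbitrary operator so that the same lemmas serve the \<open>B\<close>-norm
  and, with the inverse operator, its dual norm.\<close>

definition opnorm :: "('a::real_inner \<Rightarrow> 'a) \<Rightarrow> 'a \<Rightarrow> real" where
  "opnorm T v = sqrt (v \<bullet> T v)"

locale pos_def_operator =
  fixes T :: "'a::euclidean_space \<Rightarrow> 'a"
  assumes lin: "linear T"
    and sym: "T x \<bullet> y = x \<bullet> T y"
    and pos: "v \<noteq> 0 \<Longrightarrow> 0 < v \<bullet> T v"
begin

lemma nonneg: "0 \<le> v \<bullet> T v"
  using pos[of v] linear_0[OF lin] by (cases "v = 0") auto

lemma opnorm_nonneg [simp]: "0 \<le> opnorm T v"
  by (simp add: opnorm_def nonneg)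

lemma opnorm_sq: "(opnorm T v)\<^sup>2 = v \<bullet> T v"
  by (simp add: opnorm_def nonneg)

lemma opnorm_scale: "opnorm T (c *\<^sub>R v) = \<bar>c\<bar> * opnorm T v"
  by (simp add: opnorm_def linear_scale[OF lin] real_sqrt_mult flip: mult.assoc power2_eq_square)

lemma opnorm_uminus [simp]: "opnorm T (- v) = opnorm T v"
  using opnorm_scale[of "-1" v] by simp

lemma opnorm_minus_commute: "opnorm T (v - w) = opnorm T (w - v)"
  using opnorm_uminus[of "v - w"] by simp

text \<open>With \<open>a\<close>, \<open>b\<close> the norms of \<open>v\<close>, \<open>w\<close>,
  the form at \<open>b *\<^sub>R v - a *\<^sub>R w\<close> equals
  \<open>2 * (a * b) * (a * b - v \<bullet> T w)\<close> and is nonnegative.\<close>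

lemma Cauchy_Schwarz: "v \<bullet> T w \<le> opnorm T v * opnorm T w"
proof (cases "v = 0 \<or> w = 0")
  case True
  then show ?thesis by (auto simp: linear_0[OF lin] opnorm_def)
next
  case False
  define a where "a = opnorm T v"
  define b where "b = opnorm T w"
  have ab: "a > 0" "b > 0" using False pos[of v] pos[of w] by (simp_all add: a_def b_def opnorm_def)
  have "0 \<le> (b *\<^sub>R v - a *\<^sub>R w) \<bullet> T (b *\<^sub>R v - a *\<^sub>R w)" by (rule nonneg)
  also have "\<dots> = b\<^sup>2 * (v \<bullet> T v) + a\<^sup>2 * (w \<bullet> T w) - 2 * a * b * (v \<bullet> T w)"
    using sym[of w v] by (simp add: linear_diff[OF lin] linear_scale[OF lin] inner_diff_left
        inner_diff_right power2_eq_square algebra_simps inner_commute)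
  also have "\<dots> = 2 * (a * b) * (a * b - v \<bullet> T w)"
    unfolding a_def b_def opnorm_sq[symmetric] by (simp add: power2_eq_square algebra_simps)
  finally have "0 \<le> a * b - v \<bullet> T w"
    using ab by (metis mult_pos_pos zero_le_mult_iff zero_less_numeral not_less)
  then show ?thesis by (simp add: a_def b_def)
qed

lemma opnorm_add_scale_sq:
  "(opnorm T (v + t *\<^sub>R w))\<^sup>2 = (opnorm T v)\<^sup>2 + 2 * t * (w \<bullet> T v) + t\<^sup>2 * (opnorm T w)\<^sup>2"
  using sym[of v w] unfolding opnorm_sq
  by (simp add: linear_add[OF lin] linear_scale[OF lin] inner_add_left inner_add_right
      power2_eq_square inner_commute algebra_simps)

lemma opnorm_triangle: "opnorm T (v + w) \<le> opnorm T v + opnorm T w"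
proof (rule power2_le_imp_le)
  show "(opnorm T (v + w))\<^sup>2 \<le> (opnorm T v + opnorm T w)\<^sup>2"
    using opnorm_add_scale_sq[of v 1 w] Cauchy_Schwarz[of w v]
    by (simp add: power2_sum mult.commute)
qed simp

lemma continuous_on_opnorm [continuous_intros]:
  assumes "continuous_on S g"
  shows "continuous_on S (\<lambda>x. opnorm T (g x))"
proof -
  have "continuous_on UNIV (opnorm T)"
    unfolding opnorm_def by (intro continuous_intros continuous_on_quadratic_form lin)
  then show ?thesis using continuous_on_compose2[OF _ assms] by blast
qed

end

section \<open>Comparison of the primal, dual and Euclidean norms\<close>

locale pos_def_pair = pos_def_operator T for T :: "'a::euclidean_space \<Rightarrow> 'a" +
  fixes A :: "'a \<Rightarrow> 'a" and l L :: real
  assumes A_T [simp]: "A (T v) = v" and T_A [simp]: "T (A v) = v"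
    and l_pos: "0 < l"
    and lower: "l * (v \<bullet> v) \<le> v \<bullet> T v" and upper: "v \<bullet> T v \<le> L * (v \<bullet> v)"
begin

lemma dual_operator: "pos_def_operator A"
proof
  show "A (x + y) = A x + A y" for x y
    using A_T[of "A x + A y"] by (simp add: linear_add[OF lin])
  show "A (r *\<^sub>R x) = r *\<^sub>R A x" for r x
    using A_T[of "r *\<^sub>R A x"] by (simp add: linear_scale[OF lin])
  show "A x \<bullet> y = x \<bullet> A y" for x y
    using sym[of "A x" "A y"] by simp
  show "0 < v \<bullet> A v" if "v \<noteq> 0" for v
  proof -
    have "A v \<noteq> 0" using that T_A[of v] linear_0[OF lin] by force
    then show ?thesis using pos[of "A v"] by (simp add: inner_commute)
  qed
qed

sublocale dual: pos_def_operator A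
  by (rule dual_operator)

lemma l_le_L: "l \<le> L"
proof -
  obtain v :: 'a where "v \<in> Basis" using nonempty_Basis by blast
  then show ?thesis using lower[of v] upper[of v] by simp
qed

lemma L_pos: "0 < L"
  using l_pos l_le_L by simp

lemma dual_Cauchy_Schwarz: "v \<bullet> w \<le> opnorm A v * opnorm T w"
proof -
  have "opnorm T (A v) = opnorm A v" by (simp add: opnorm_def inner_commute)
  moreover have "A v \<bullet> T w = v \<bullet> w" by (metis T_A sym)
  ultimately show ?thesis using Cauchy_Schwarz[of "A v" w] by simp
qed

lemma abs_dual_Cauchy_Schwarz: "\<bar>v \<bullet> w\<bar> \<le> opnorm A v * opnorm T w"
  using dual_Cauchy_Schwarz[of v w] dual_Cauchy_Schwarz[of "- v" w] by simp

text \<open>The test vector \<open>A v\<close> has primal norm equal to the dual norm of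
  \<open>v\<close>, so one factor cancels. Through this, dual norms of integrals are bounded by
  integrating scalar inequalities.\<close>

lemma dual_norm_leI:
  assumes "\<And>w. v \<bullet> w \<le> c * opnorm T w" and "0 \<le> c"
  shows "opnorm A v \<le> c"
proof -
  have "opnorm T (A v) = opnorm A v" by (simp add: opnorm_def inner_commute)
  then have "opnorm A v * opnorm A v \<le> c * opnorm A v"
    using assms(1)[of "A v"] by (simp flip: dual.opnorm_sq power2_eq_square)
  then show ?thesis using assms(2) by (metis dual.opnorm_nonneg mult_le_cancel_right_pos order_le_less)
qed

lemma norm_le_opnorm: "l * (norm v)\<^sup>2 \<le> (opnorm T v)\<^sup>2"
  using lower[of v] by (simp add: opnorm_sq dot_square_norm)

lemma opnorm_le_norm: "(opnorm T v)\<^sup>2 \<le> L * (norm v)\<^sup>2"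
  using upper[of v] by (simp add: opnorm_sq dot_square_norm)

text \<open>For \<open>w = A v\<close> the squared dual norm of \<open>v\<close> is
  \<open>w \<bullet> v\<close>, and the lower bound for \<open>T\<close> at \<open>w\<close>
  controls \<open>norm w\<close> by that dual norm. No spectrum of the inverse is involved.\<close>

lemma dual_le_norm: "l * (opnorm A v)\<^sup>2 \<le> (norm v)\<^sup>2"
proof (cases "v = 0")
  case False
  define a where "a = opnorm A v"
  define w where "w = A v"
  have a: "a > 0" using False dual.pos[of v] by (simp add: a_def opnorm_def)
  have w: "opnorm T w = a" by (simp add: w_def a_def opnorm_def inner_commute)
  have "a\<^sup>2 = w \<bullet> v" by (simp add: a_def dual.opnorm_sq w_def inner_commute)
  also have "\<dots> \<le> norm w * norm v" by (rule norm_cauchy_schwarz)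
  finally have "(a\<^sup>2)\<^sup>2 \<le> (norm w * norm v)\<^sup>2" by (rule power_mono) simp
  then have "l * (a\<^sup>2)\<^sup>2 \<le> (l * (norm w)\<^sup>2) * (norm v)\<^sup>2"
    using l_pos by (simp add: power_mult_distrib)
  also have "\<dots> \<le> a\<^sup>2 * (norm v)\<^sup>2"
    using norm_le_opnorm[of w] by (intro mult_right_mono) (simp_all add: w)
  finally show ?thesis using a by (simp add: a_def[symmetric] power2_eq_square)
qed (simp add: opnorm_def)

text \<open>Duality bounds \<open>v \<bullet> v\<close> by the product of both norms; the primal one
  is then bounded by the Euclidean norm, which cancels.\<close>

lemma norm_le_dual: "(norm v)\<^sup>2 \<le> L * (opnorm A v)\<^sup>2"
proof (cases "v = 0")
  case False
  have "(norm v)\<^sup>2 \<le> opnorm A v * opnorm T v"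
    using dual_Cauchy_Schwarz[of v v] by (simp add: dot_square_norm)
  then have "((norm v)\<^sup>2)\<^sup>2 \<le> (opnorm A v)\<^sup>2 * (opnorm T v)\<^sup>2"
    by (metis power_mono power_mult_distrib zero_le_power2)
  also have "\<dots> \<le> (opnorm A v)\<^sup>2 * (L * (norm v)\<^sup>2)"
    by (intro mult_left_mono opnorm_le_norm) simp
  finally have "(norm v)\<^sup>2 * (norm v)\<^sup>2 \<le> (L * (opnorm A v)\<^sup>2) * (norm v)\<^sup>2"
    by (simp add: power2_eq_square ac_simps)
  then show ?thesis using False by (metis mult_le_cancel_right_pos zero_less_norm_iff zero_less_power)
qed (simp add: opnorm_def)

lemma opnorm_le_dual: "opnorm T v \<le> L * opnorm A v"
proof (rule power2_le_imp_le)
  have "(opnorm T v)\<^sup>2 \<le> L * (norm v)\<^sup>2" by (rule opnorm_le_norm)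
  also have "\<dots> \<le> L * (L * (opnorm A v)\<^sup>2)"
    using L_pos by (intro mult_left_mono norm_le_dual) simp
  finally show "(opnorm T v)\<^sup>2 \<le> (L * opnorm A v)\<^sup>2"
    by (simp add: power2_eq_square ac_simps)
qed (use L_pos in simp)

lemma dual_le_opnorm: "l * opnorm A v \<le> opnorm T v"
proof (rule power2_le_imp_le)
  have "l * (l * (opnorm A v)\<^sup>2) \<le> l * (norm v)\<^sup>2"
    using l_pos by (intro mult_left_mono dual_le_norm) simp
  also have "\<dots> \<le> (opnorm T v)\<^sup>2" by (rule norm_le_opnorm)
  finally show "(l * opnorm A v)\<^sup>2 \<le> (opnorm T v)\<^sup>2"
    by (simp add: power2_eq_square ac_simps)
qed simp

end

subsection \<open>Projection in an operator norm\<close>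

text \<open>The square is kept so that this unfolds to \<open>projB\<close> once the norms are
  identified.\<close>

definition op_proj :: "('a::real_inner \<Rightarrow> 'a) \<Rightarrow> 'a set \<Rightarrow> 'a \<Rightarrow> 'a" where
  "op_proj T Z w = arg_min (\<lambda>z. (opnorm T (z - w))\<^sup>2) (\<lambda>z. z \<in> Z)"

context pos_def_operator
begin

context
  fixes Z :: "'a set"
  assumes Z: "compact Z" "convex Z" "Z \<noteq> {}"
begin

lemma op_proj_in: "op_proj T Z w \<in> Z"
  and op_proj_le: "y \<in> Z \<Longrightarrow> opnorm T (op_proj T Z w - w) \<le> opnorm T (y - w)"
proof -
  have "continuous_on Z (\<lambda>z. opnorm T (z - w))" by (intro continuous_intros)
  then obtain p where p: "p \<in> Z" "\<And>y. y \<in> Z \<Longrightarrow> opnorm T (p - w) \<le> opnorm T (y - w)"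
    using continuous_attains_inf[OF Z(1,3)] by blast
  then have "is_arg_min (\<lambda>z. (opnorm T (z - w))\<^sup>2) (\<lambda>z. z \<in> Z) p"
    by (auto simp: is_arg_min_linorder intro!: power_mono)
  then have *: "is_arg_min (\<lambda>z. (opnorm T (z - w))\<^sup>2) (\<lambda>z. z \<in> Z) (op_proj T Z w)"
    unfolding op_proj_def arg_min_def by (rule someI)
  then show "op_proj T Z w \<in> Z" by (simp add: is_arg_min_def)
  show "opnorm T (op_proj T Z w - w) \<le> opnorm T (y - w)" if "y \<in> Z"
    using * that by (auto simp: is_arg_min_linorder intro: power2_le_imp_le)
qed

text \<open>Convexity allows moving from the projection \<open>p\<close> a fraction \<open>t\<close>
  towards \<open>y\<close>. Minimality then gives \<open>2 * t * a \<le> t\<^sup>2 * b\<close>,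
  which fails for small \<open>t\<close> if \<open>a\<close> is positive.\<close>

lemma op_proj_variational:
  assumes y: "y \<in> Z"
  shows "(y - op_proj T Z w) \<bullet> T (w - op_proj T Z w) \<le> 0"
proof (rule ccontr)
  define p where "p = op_proj T Z w"
  define a where "a = (y - p) \<bullet> T (w - p)"
  define b where "b = (y - p) \<bullet> T (y - p)"
  assume "\<not> (y - op_proj T Z w) \<bullet> T (w - op_proj T Z w) \<le> 0"
  then have a: "a > 0" by (simp add: a_def p_def)
  have b: "b \<ge> 0" unfolding b_def by (rule nonneg)
  have key: "2 * t * a \<le> t\<^sup>2 * b" if "0 \<le> t" "t \<le> 1" for t
  proof -
    have "(1 - t) *\<^sub>R p + t *\<^sub>R y \<in> Z"
      using Z(2) that y op_proj_in[of w] unfolding convex_alt p_def by blast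
    then have "(opnorm T (p - w))\<^sup>2 \<le> (opnorm T (((1 - t) *\<^sub>R p + t *\<^sub>R y) - w))\<^sup>2"
      unfolding p_def by (intro power_mono op_proj_le opnorm_nonneg)
    also have "((1 - t) *\<^sub>R p + t *\<^sub>R y) - w = (p - w) + t *\<^sub>R (y - p)"
      by (simp add: algebra_simps)
    also have "(opnorm T ((p - w) + t *\<^sub>R (y - p)))\<^sup>2
        = (opnorm T (p - w))\<^sup>2 + t\<^sup>2 * b + 2 * t * ((y - p) \<bullet> T (p - w))"
      unfolding opnorm_add_scale_sq b_def by (simp add: opnorm_sq)
    also have "(y - p) \<bullet> T (p - w) = - a"
      by (simp add: a_def linear_diff[OF lin] inner_diff_right)
    finally show ?thesis by simp
  qed
  \<comment> \<open>This choice lies in the admissible interval and yields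
    \<open>t * b \<le> a\<close>, contradicting \<open>2 * a \<le> t * b\<close>.\<close>
  define t where "t = a / (a + b)"
  have t: "0 < t" "t \<le> 1" using a b by (simp_all add: t_def)
  then have "t * (2 * a) \<le> t * (t * b)" using key[of t] by (simp add: power2_eq_square ac_simps)
  then have "2 * a \<le> t * b" using t by simp
  also have "\<dots> \<le> a" using a b by (simp add: t_def field_simps)
  finally show False using a by simp
qed

text \<open>Each projection is tested in the variational inequality of the other; adding the two and
  applying Cauchy-Schwarz leaves a common factor to cancel.\<close>

lemma op_proj_nonexpansive: "opnorm T (op_proj T Z v - op_proj T Z w) \<le> opnorm T (v - w)"
proof -
  define p where "p = op_proj T Z v"
  define q where "q = op_proj T Z w"
  have "(q - p) \<bullet> T (v - p) \<le> 0" "(p - q) \<bullet> T (w - q) \<le> 0"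
    unfolding p_def q_def by (intro op_proj_variational op_proj_in)+
  then have "(p - q) \<bullet> T (p - q) \<le> (p - q) \<bullet> T (v - w)"
    by (simp add: linear_diff[OF lin] inner_diff_left inner_diff_right)
  then have "(opnorm T (p - q))\<^sup>2 \<le> opnorm T (p - q) * opnorm T (v - w)"
    using Cauchy_Schwarz[of "p - q" "v - w"] by (simp add: opnorm_sq)
  then show ?thesis
    unfolding p_def[symmetric] q_def[symmetric] power2_eq_square
    by (metis mult_le_cancel_left_pos opnorm_nonneg order_le_less)
qed

end
end

text \<open>Nonexpansiveness in the operator norm becomes Lipschitz continuity with constant
  \<open>sqrt (L / l)\<close> in the Euclidean norm. It supplies measurability of the
  iterates.\<close>

lemma (in pos_def_pair) continuous_on_op_proj:
  assumes Z: "compact Z" "convex Z" "Z \<noteq> {}"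
  shows "continuous_on UNIV (op_proj T Z)"
proof (rule continuous_onI)
  fix x and e :: real assume e: "e > 0"
  define c where "c = sqrt (L / l)"
  have c: "c > 0" using l_pos L_pos by (simp add: c_def)
  have lip: "norm (op_proj T Z y - op_proj T Z x) \<le> c * norm (y - x)" for y
  proof (rule power2_le_imp_le)
    have "l * (norm (op_proj T Z y - op_proj T Z x))\<^sup>2 \<le> (opnorm T (op_proj T Z y - op_proj T Z x))\<^sup>2"
      by (rule norm_le_opnorm)
    also have "\<dots> \<le> (opnorm T (y - x))\<^sup>2"
      by (intro power_mono op_proj_nonexpansive Z opnorm_nonneg)
    also have "\<dots> \<le> L * (norm (y - x))\<^sup>2" by (rule opnorm_le_norm)
    finally show "(norm (op_proj T Z y - op_proj T Z x))\<^sup>2 \<le> (c * norm (y - x))\<^sup>2"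
      using l_pos L_pos by (simp add: c_def power_mult_distrib field_simps)
  qed (use c in simp)
  show "\<exists>d>0. \<forall>x'\<in>UNIV. dist x' x < d \<longrightarrow> dist (op_proj T Z x') (op_proj T Z x) \<le> e"
  proof (intro exI[of _ "e / c"] conjI ballI impI)
    fix y assume "dist y x < e / c"
    then have "c * norm (y - x) \<le> e" using c by (simp add: dist_norm field_simps)
    then show "dist (op_proj T Z y) (op_proj T Z x) \<le> e"
      using lip[of y] by (simp add: dist_norm)
  qed (use e c in simp)
qed

subsection \<open>Gaussian moments\<close>

text \<open>The constant \<open>c\<close> is known only through the total mass being one, so no
  determinant has to be evaluated.\<close>

locale gaussian_pair = pos_def_pair T A l L
  for T A :: "'a::euclidean_space \<Rightarrow> 'a" and l L +
  fixes c :: real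
  assumes c_nonneg: "0 \<le> c"
    and prob_gauss: "prob_space (density lborel (\<lambda>u. ennreal (c * exp (- (u \<bullet> T u) / 2))))"
begin

definition gauss :: "'a measure" where
  "gauss = density lborel (\<lambda>u. ennreal (c * exp (- (u \<bullet> T u) / 2)))"

sublocale gauss: prob_space gauss
  unfolding gauss_def by (rule prob_gauss)

lemma sets_gauss [simp, measurable_cong]: "sets gauss = sets borel"
  by (simp add: gauss_def)

lemma space_gauss [simp]: "space gauss = UNIV"
  by (simp add: gauss_def)

lemma T_measurable [measurable]: "T \<in> borel_measurable borel"
  using lin by (intro borel_measurable_continuous_onI linear_continuous_on) (simp add: linear_conv_bounded_linear)

text \<open>Rescaling the variable by \<open>1 / sqrt s\<close> turns the weight
  \<open>exp (- s * (u \<bullet> T u) / 2)\<close> into the Gaussian one. What remains is the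
  Jacobian times the total mass.\<close>

lemma gaussian_exp_moment:
  assumes s: "0 < s"
  shows "(\<integral>\<^sup>+u. ennreal (exp ((1 - s) * (u \<bullet> T u) / 2)) \<partial>gauss) = ennreal ((1 / sqrt s) ^ DIM('a))"
proof -
  define k where "k = 1 / sqrt s"
  have k: "k > 0" "k * k * s = 1" using s by (simp_all add: k_def)
  have "(\<integral>\<^sup>+u. ennreal (exp ((1 - s) * (u \<bullet> T u) / 2)) \<partial>gauss)
      = (\<integral>\<^sup>+u. ennreal (c * exp (- (u \<bullet> T u) / 2)) * ennreal (exp ((1 - s) * (u \<bullet> T u) / 2)) \<partial>lborel)"
    unfolding gauss_def by (subst nn_integral_density) auto
  also have "\<dots> = (\<integral>\<^sup>+u. ennreal (c * exp (- s * (u \<bullet> T u) / 2)) \<partial>lborel)"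
    using c_nonneg by (intro nn_integral_cong)
      (simp add: ennreal_mult'[symmetric] mult.assoc exp_add[symmetric] field_simps)
  also have "\<dots> = (\<integral>\<^sup>+u. ennreal (c * exp (- s * (u \<bullet> T u) / 2))
      \<partial>density (distr lborel borel (\<lambda>x. 0 + k *\<^sub>R x)) (\<lambda>_. \<bar>k\<bar>^DIM('a)))"
    using lborel_affine[of k "0::'a"] k by simp
  also have "\<dots> = (\<integral>\<^sup>+u. ennreal (k ^ DIM('a)) * ennreal (c * exp (- (u \<bullet> T u) / 2)) \<partial>lborel)"
  proof -
    have "- s * ((k *\<^sub>R u) \<bullet> T (k *\<^sub>R u)) / 2 = - (u \<bullet> T u) / 2" for u
    proof -
      have "s * ((k *\<^sub>R u) \<bullet> T (k *\<^sub>R u)) = (k * k * s) * (u \<bullet> T u)"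
        by (simp add: linear_scale[OF lin])
      then show ?thesis using k by simp
    qed
    then show ?thesis using k by (simp add: nn_integral_density nn_integral_distr)
  qed
  also have "\<dots> = ennreal (k ^ DIM('a)) * (\<integral>\<^sup>+u. ennreal (c * exp (- (u \<bullet> T u) / 2)) \<partial>lborel)"
    by (rule nn_integral_cmult) simp
  also have "(\<integral>\<^sup>+u. ennreal (c * exp (- (u \<bullet> T u) / 2)) \<partial>lborel) = emeasure gauss UNIV"
    unfolding gauss_def by (subst emeasure_density) auto
  also have "\<dots> = 1" using gauss.emeasure_space_1 by simp
  finally show ?thesis by (simp add: k_def)
qed

text \<open>With \<open>d\<close> the dimension, \<open>1 / (1 - eps) = 1 + 1 / d\<close>, whose
  \<open>d\<close>-th power is at most e. The exponential moment is the square root of that power,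
  so it stays below 2 in every dimension.\<close>

definition eps :: real where "eps = 1 / (real DIM('a) + 1)"

lemma eps: "0 < eps" "eps < 1"
  by (simp_all add: eps_def)

lemma gaussian_exp_moment_bound:
  shows "integrable gauss (\<lambda>u. exp (eps * (u \<bullet> T u) / 2))"
    and "(\<integral>u. exp (eps * (u \<bullet> T u) / 2) \<partial>gauss) \<le> 2"
proof -
  define n where "n = DIM('a)"
  have n: "n \<ge> 1" by (simp add: n_def Suc_leI)
  define K where "K = (1 / sqrt (1 - eps)) ^ n"
  have inv: "1 / (1 - eps) = 1 + 1 / n" using n by (simp add: eps_def n_def field_simps)
  have "K\<^sup>2 = (1 / (1 - eps)) ^ n"
    unfolding K_def using eps
    by (simp add: power_mult_distrib power_divide flip: power_mult) (simp add: power_mult mult.commute[of n])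
  also have "\<dots> \<le> exp 1" unfolding inv
    using exp_ge_one_plus_x_over_n_power_n[of n 1] n by simp
  also have "\<dots> \<le> 2\<^sup>2" using exp_le by simp
  finally have K: "K \<le> 2" by (rule power2_le_imp_le) simp
  have eq: "(\<integral>\<^sup>+u. ennreal (exp (eps * (u \<bullet> T u) / 2)) \<partial>gauss) = ennreal K"
    using gaussian_exp_moment[of "1 - eps"] eps by (simp add: K_def n_def)
  show int: "integrable gauss (\<lambda>u. exp (eps * (u \<bullet> T u) / 2))"
    by (rule integrableI_nonneg) (use eq in auto)
  have "K \<ge> 0" unfolding K_def using eps by simp
  then have "(\<integral>u. exp (eps * (u \<bullet> T u) / 2) \<partial>gauss) = K"
    using eq by (subst integral_eq_nn_integral) auto
  with K show "(\<integral>u. exp (eps * (u \<bullet> T u) / 2) \<partial>gauss) \<le> 2" by simp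
qed

text \<open>The exponent 6 suffices for the squared estimator, which is the fastest growing integrand.\<close>

lemma poly_le_exp: "\<exists>K\<ge>0. \<forall>u. (1 + norm u) ^ 6 \<le> K * exp (eps * (u \<bullet> T u) / 2)"
proof -
  define a where "a = eps * l / 2"
  have a: "a > 0" using eps l_pos by (simp add: a_def)
  show ?thesis
  \<comment> \<open>With \<open>x = 1 + r\<^sup>2\<close>, the 8 is the cube of 2 in
    \<open>(1 + r)\<^sup>2 \<le> 2 * x\<close>, the factor \<open>27 / a ^ 3\<close> comes from
    \<open>(a * x / 3) ^ 3 \<le> exp (a * x)\<close>, and \<open>exp a\<close> from the summand 1 of
    \<open>x\<close>.\<close>
  proof (intro exI[of _ "8 * (27 / a ^ 3 * exp a)"] conjI allI)
    fix u :: 'a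
    define r where "r = norm u"
    define x where "x = 1 + r\<^sup>2"
    have x: "x \<ge> 0" by (simp add: x_def)
    have "(1 + r)\<^sup>2 \<le> 2 * x" using zero_le_power2[of "1 - r"] by (simp add: x_def power2_sum power2_diff)
    then have "((1 + r)\<^sup>2) ^ 3 \<le> (2 * x) ^ 3" by (intro power_mono) auto
    then have 1: "(1 + r) ^ 6 \<le> 8 * x ^ 3" by (simp add: power_mult_distrib flip: power_mult)
    have "(a * x / 3) ^ 3 \<le> exp (a * x / 3) ^ 3"
      using a x exp_ge_add_one_self[of "a * x / 3"] by (intro power_mono) (linarith, simp)
    also have "\<dots> = exp (a * x)" by (simp flip: exp_of_nat_mult)
    finally have "x ^ 3 \<le> 27 / a ^ 3 * exp (a * x)"
      using a by (simp add: power_divide power_mult_distrib field_simps)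
    also have "a * x \<le> a + eps * (u \<bullet> T u) / 2"
      using lower[of u] eps by (simp add: a_def x_def r_def dot_square_norm distrib_left)
    then have "27 / a ^ 3 * exp (a * x) \<le> 27 / a ^ 3 * exp (a + eps * (u \<bullet> T u) / 2)"
      using a by (intro mult_left_mono) auto
    finally show "(1 + norm u) ^ 6 \<le> 8 * (27 / a ^ 3 * exp a) * exp (eps * (u \<bullet> T u) / 2)"
      using 1 by (simp add: r_def exp_add)
  qed (use a in simp)
qed

lemma integrable_poly_growth:
  fixes g :: "'a \<Rightarrow> 'b::{banach, second_countable_topology}"
  assumes g: "g \<in> borel_measurable borel" and bound: "\<And>u. norm (g u) \<le> C * (1 + norm u) ^ 6"
  shows "integrable gauss g"
proof -
  obtain K where K: "K \<ge> 0" "\<And>u. (1 + norm u) ^ 6 \<le> K * exp (eps * (u \<bullet> T u) / 2)"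
    using poly_le_exp by blast
  have "C \<ge> 0" using bound[of 0] order_trans[OF norm_ge_zero] by fastforce
  have "norm (g u) \<le> norm (C * K * exp (eps * (u \<bullet> T u) / 2))" for u
  proof -
    have "norm (g u) \<le> C * (K * exp (eps * (u \<bullet> T u) / 2))"
      using bound[of u] mult_left_mono[OF K(2)[of u] \<open>C \<ge> 0\<close>] by linarith
    then show ?thesis using \<open>C \<ge> 0\<close> K(1) by (simp add: abs_mult mult.assoc)
  qed
  moreover have "integrable gauss (\<lambda>u. C * K * exp (eps * (u \<bullet> T u) / 2))"
    by (intro integrable_mult_right gaussian_exp_moment_bound(1))
  ultimately show ?thesis
    using g by (intro Bochner_Integration.integrable_bound
        [of gauss "\<lambda>u. C * K * exp (eps * (u \<bullet> T u) / 2)" g]) auto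
qed

lemma opnorm_measurable [measurable]: "opnorm T \<in> borel_measurable borel"
  by (intro borel_measurable_continuous_onI continuous_on_opnorm[of UNIV "\<lambda>x. x", simplified] continuous_intros)

text \<open>For \<open>t\<close> the norm of \<open>u\<close>,
  \<open>t \<le> 1 / 2 + t\<^sup>2 / 2\<close> and
  \<open>t\<^sup>2 / 2 \<le> (exp (eps * t\<^sup>2 / 2) - 1) / eps\<close>. With the exponential
  moment at most 2, the mean is at most \<open>1 / eps + 1 / 2\<close>.\<close>

lemma opnorm_first_moment:
  shows "integrable gauss (opnorm T)"
    and "(\<integral>u. opnorm T u \<partial>gauss) \<le> real DIM('a) + 3 / 2"
proof -
  have le: "opnorm T u \<le> exp (eps * (u \<bullet> T u) / 2) / eps + (1 / 2 - 1 / eps)" for u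
  proof -
    have "2 * opnorm T u \<le> 1 + (opnorm T u)\<^sup>2"
      using zero_le_power2[of "opnorm T u - 1"] by (simp add: power2_diff)
    moreover have "(opnorm T u)\<^sup>2 / 2 \<le> exp (eps * (u \<bullet> T u) / 2) / eps - 1 / eps"
      using exp_ge_add_one_self[of "eps * (u \<bullet> T u) / 2"] eps by (simp add: opnorm_sq field_simps)
    ultimately show ?thesis by linarith
  qed
  have bi: "integrable gauss (\<lambda>u. exp (eps * (u \<bullet> T u) / 2) / eps + (1 / 2 - 1 / eps))"
    by (intro Bochner_Integration.integrable_add integrable_divide_zero
        gaussian_exp_moment_bound(1)) auto
  show int: "integrable gauss (opnorm T)"
    by (rule Bochner_Integration.integrable_bound[OF bi])
      (use le in \<open>auto intro!: AE_I2 intro: order_trans[OF _ abs_ge_self]\<close>)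
  have "(\<integral>u. opnorm T u \<partial>gauss) \<le> (\<integral>u. exp (eps * (u \<bullet> T u) / 2) / eps + (1 / 2 - 1 / eps) \<partial>gauss)"
    by (intro integral_mono int bi le)
  also have "\<dots> = (\<integral>u. exp (eps * (u \<bullet> T u) / 2) \<partial>gauss) / eps + (1 / 2 - 1 / eps)"
    using gaussian_exp_moment_bound(1) gauss.prob_space by simp
  also have "\<dots> \<le> 2 / eps + (1 / 2 - 1 / eps)"
    using gaussian_exp_moment_bound(2) eps by (intro add_right_mono divide_right_mono) auto
  also have "\<dots> = real DIM('a) + 3 / 2" by (simp add: eps_def)
  finally show "(\<integral>u. opnorm T u \<partial>gauss) \<le> real DIM('a) + 3 / 2" .
qed

end

subsection \<open>Gaussian smoothing of a function with Lipschitz gradient\<close>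

text \<open>A quadratic remainder divided by the norm of the increment tends to zero. Such a
  remainder bound survives integration, so the smoothing can be differentiated without a limit
  theorem.\<close>

lemma GDERIV_I_quadratic:
  fixes f :: "'a::real_inner \<Rightarrow> real"
  assumes "\<And>v. \<bar>f (z + v) - f z - v \<bullet> D\<bar> \<le> C * (norm v)\<^sup>2"
  shows "GDERIV f z :> D"
  unfolding gderiv_def has_derivative_at
proof
  show "bounded_linear (\<lambda>h. h \<bullet> D)" by (rule bounded_linear_inner_left)
  show "(\<lambda>h. norm (f (z + h) - f z - h \<bullet> D) / norm h) \<midarrow>0\<rightarrow> 0"
  proof (rule tendsto_sandwich[where f = "\<lambda>_. 0" and h = "\<lambda>h. C * norm h"])
    show "\<forall>\<^sub>F h in at 0. norm (f (z + h) - f z - h \<bullet> D) / norm h \<le> C * norm h"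
    proof (rule always_eventually, rule allI)
      fix h
      show "norm (f (z + h) - f z - h \<bullet> D) / norm h \<le> C * norm h"
        using assms[of h] by (cases "h = 0") (auto simp: field_simps power2_eq_square)
    qed
    show "(\<lambda>h. C * norm h) \<midarrow>0\<rightarrow> 0"
      by (rule tendsto_eq_intros refl | simp)+
  qed auto
qed

locale smooth_objective = gaussian_pair T A l L c
  for T A :: "'a::euclidean_space \<Rightarrow> 'a" and l L c +
  fixes f :: "'a \<Rightarrow> real" and g :: "'a \<Rightarrow> 'a" and L1 \<mu> :: real
  assumes grad: "GDERIV f z :> g z"
    and lip: "opnorm A (g v - g w) \<le> L1 * opnorm T (v - w)"
    and L1_pos: "0 < L1" and \<mu>_pos: "0 < \<mu>"
begin

text \<open>The mean value theorem on the segment from \<open>z\<close> to \<open>z + v\<close>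
  reduces this to the gradient difference at an intermediate point. The constant \<open>L1\<close>
  instead of its half suffices for growth estimates and differentiability.\<close>

lemma second_order_bound: "\<bar>f (z + v) - f z - v \<bullet> g z\<bar> \<le> L1 * (opnorm T v)\<^sup>2"
proof -
  have "\<exists>t\<in>{0<..<1}. f (z + 1 *\<^sub>R v) - f (z + 0 *\<^sub>R v) = ((1 - 0) *\<^sub>R v) \<bullet> g (z + t *\<^sub>R v)"
  proof (rule mvt_simple)
    fix t :: real
    have "(f has_derivative (\<lambda>h. h \<bullet> g (z + t *\<^sub>R v))) (at (z + t *\<^sub>R v))"
      using grad by (simp add: gderiv_def)
    moreover have "((\<lambda>t. z + t *\<^sub>R v) has_derivative (\<lambda>t. t *\<^sub>R v)) (at t within {0..1})"
      by (auto intro!: derivative_eq_intros)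
    ultimately show "((\<lambda>t. f (z + t *\<^sub>R v)) has_derivative (\<lambda>h. (h *\<^sub>R v) \<bullet> g (z + t *\<^sub>R v))) (at t within {0..1})"
      by (rule has_derivative_compose[rotated])
  qed simp
  then obtain t where t: "0 < t" "t < 1" "f (z + v) - f z = v \<bullet> g (z + t *\<^sub>R v)" by auto
  have "\<bar>f (z + v) - f z - v \<bullet> g z\<bar> = \<bar>(g (z + t *\<^sub>R v) - g z) \<bullet> v\<bar>"
    unfolding t by (simp add: inner_diff_right inner_commute[of _ v])
  also have "\<dots> \<le> opnorm A (g (z + t *\<^sub>R v) - g z) * opnorm T v"
    by (rule abs_dual_Cauchy_Schwarz)
  also have "\<dots> \<le> (L1 * opnorm T v) * opnorm T v"
  proof (rule mult_right_mono[OF order_trans[OF lip]])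
    show "L1 * opnorm T (z + t *\<^sub>R v - z) \<le> L1 * opnorm T v"
      using t L1_pos by (simp add: opnorm_scale mult_left_le_one_le)
  qed simp
  finally show ?thesis by (simp add: power2_eq_square)
qed

lemma gradient_norm_lipschitz: "norm (g v - g w) \<le> L * L1 * norm (v - w)"
proof (rule power2_le_imp_le)
  have "(norm (g v - g w))\<^sup>2 \<le> L * (opnorm A (g v - g w))\<^sup>2" by (rule norm_le_dual)
  also have "\<dots> \<le> L * (L1 * opnorm T (v - w))\<^sup>2"
    using L_pos by (intro mult_left_mono power_mono lip) auto
  also have "\<dots> \<le> L * (L1\<^sup>2 * (L * (norm (v - w))\<^sup>2))"
    unfolding power_mult_distrib using L_pos by (intro mult_left_mono opnorm_le_norm) auto
  finally show "(norm (g v - g w))\<^sup>2 \<le> (L * L1 * norm (v - w))\<^sup>2"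
    by (simp add: power2_eq_square ac_simps)
qed (use L_pos L1_pos in simp)

lemma continuous_on_gradient: "continuous_on UNIV g"
proof (rule continuous_onI)
  fix x and e :: real assume e: "e > 0"
  have C: "0 < L * L1" using L_pos L1_pos by simp
  show "\<exists>d>0. \<forall>x'\<in>UNIV. dist x' x < d \<longrightarrow> dist (g x') (g x) \<le> e"
  proof (intro exI[of _ "e / (L * L1)"] conjI ballI impI)
    fix y assume "dist y x < e / (L * L1)"
    then have "L * L1 * norm (y - x) \<le> e" using C by (simp add: dist_norm field_simps)
    then show "dist (g y) (g x) \<le> e"
      using gradient_norm_lipschitz[of y x] by (simp add: dist_norm)
  qed (use e C in simp)
qed

lemma continuous_on_objective: "continuous_on UNIV f"
  using grad unfolding gderiv_def
  by (intro continuous_at_imp_continuous_on ballI) (blast intro: has_derivative_continuous)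

lemma objective_measurable [measurable]: "f \<in> borel_measurable borel"
  by (intro borel_measurable_continuous_onI continuous_on_objective)

lemma gradient_measurable [measurable]: "g \<in> borel_measurable borel"
  by (intro borel_measurable_continuous_onI continuous_on_gradient)

text \<open>Quadratic growth here, times the linear factor \<open>T u\<close>, makes the estimator
  cubic and its square of degree six.\<close>

lemma increment_growth:
  "\<exists>C\<ge>0. \<forall>u. \<bar>f (z + \<mu> *\<^sub>R u) - f z\<bar> \<le> C * (1 + norm u)\<^sup>2"
proof (intro exI[of _ "\<mu> * norm (g z) + L1 * L * \<mu>\<^sup>2"] conjI allI)
  fix u :: 'a
  let ?r = "norm u"
  have "\<bar>f (z + \<mu> *\<^sub>R u) - f z\<bar> \<le> \<bar>(\<mu> *\<^sub>R u) \<bullet> g z\<bar> + L1 * (opnorm T (\<mu> *\<^sub>R u))\<^sup>2"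
    using second_order_bound[of z "\<mu> *\<^sub>R u"] by linarith
  also have "\<dots> \<le> norm (\<mu> *\<^sub>R u) * norm (g z) + L1 * (L * (norm (\<mu> *\<^sub>R u))\<^sup>2)"
    using L1_pos by (intro add_mono Cauchy_Schwarz_ineq2 mult_left_mono opnorm_le_norm) auto
  also have "\<dots> = \<mu> * norm (g z) * ?r + L1 * L * \<mu>\<^sup>2 * ?r\<^sup>2"
    using \<mu>_pos by (simp add: power_mult_distrib)
  also have "\<dots> \<le> \<mu> * norm (g z) * (1 + ?r)\<^sup>2 + L1 * L * \<mu>\<^sup>2 * (1 + ?r)\<^sup>2"
    using \<mu>_pos L1_pos L_pos by (intro add_mono mult_left_mono) (auto simp: power2_sum)
  finally show "\<bar>f (z + \<mu> *\<^sub>R u) - f z\<bar> \<le> (\<mu> * norm (g z) + L1 * L * \<mu>\<^sup>2) * (1 + ?r)\<^sup>2"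
    by (simp add: algebra_simps)
qed (use \<mu>_pos L1_pos L_pos in simp)

lemma integrable_shifted_objective: "integrable gauss (\<lambda>u. f (z + \<mu> *\<^sub>R u))"
proof -
  obtain C where C: "C \<ge> 0" "\<And>u. \<bar>f (z + \<mu> *\<^sub>R u) - f z\<bar> \<le> C * (1 + norm u)\<^sup>2"
    using increment_growth by blast
  have "integrable gauss (\<lambda>u. f (z + \<mu> *\<^sub>R u) - f z)"
  proof (rule integrable_poly_growth[where C = C])
    fix u :: 'a
    have "(1 + norm u)\<^sup>2 \<le> (1 + norm u) ^ 6" by (intro power_increasing) auto
    then show "norm (f (z + \<mu> *\<^sub>R u) - f z) \<le> C * (1 + norm u) ^ 6"
      using C(2)[of u] mult_left_mono[of "(1 + norm u)\<^sup>2" _ C] C(1) by fastforce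
  qed measurable
  then have "integrable gauss (\<lambda>u. (f (z + \<mu> *\<^sub>R u) - f z) + f z)"
    by (intro Bochner_Integration.integrable_add) auto
  then show ?thesis by simp
qed

lemma integrable_shifted_gradient: "integrable gauss (\<lambda>u. g (z + \<mu> *\<^sub>R u))"
proof -
  have "integrable gauss (\<lambda>u. g (z + \<mu> *\<^sub>R u) - g z)"
  proof (rule integrable_poly_growth[where C = "L * L1 * \<mu>"])
    fix u :: 'a
    have "norm (g (z + \<mu> *\<^sub>R u) - g z) \<le> L * L1 * \<mu> * norm u"
      using gradient_norm_lipschitz[of "z + \<mu> *\<^sub>R u" z] \<mu>_pos by simp
    also have "\<dots> \<le> L * L1 * \<mu> * (1 + norm u) ^ 6"
      using \<mu>_pos L1_pos L_pos power_increasing[of 1 6 "1 + norm u"] by (intro mult_left_mono) auto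
    finally show "norm (g (z + \<mu> *\<^sub>R u) - g z) \<le> L * L1 * \<mu> * (1 + norm u) ^ 6" .
  qed measurable
  then have "integrable gauss (\<lambda>u. (g (z + \<mu> *\<^sub>R u) - g z) + g z)"
    by (intro Bochner_Integration.integrable_add) auto
  then show ?thesis by simp
qed

section \<open>The smoothed function: gradient, Lipschitz constant and bias\<close>

definition smooth_f :: "'a \<Rightarrow> real" where
  "smooth_f z = (\<integral>u. f (z + \<mu> *\<^sub>R u) \<partial>gauss)"

definition smooth_g :: "'a \<Rightarrow> 'a" where
  "smooth_g z = (\<integral>u. g (z + \<mu> *\<^sub>R u) \<partial>gauss)"

lemma inner_smooth_g: "smooth_g z \<bullet> v = (\<integral>u. g (z + \<mu> *\<^sub>R u) \<bullet> v \<partial>gauss)"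
  unfolding smooth_g_def by (intro integral_inner_left[symmetric] impI integrable_shifted_gradient)

text \<open>Averaging the second order bound over all shifts \<open>z + \<mu> *\<^sub>R u\<close>
  gives a quadratic remainder for the average.\<close>

lemma GDERIV_smooth: "GDERIV smooth_f z :> smooth_g z"
proof (rule GDERIV_I_quadratic)
  fix v
  have i: "integrable gauss (\<lambda>u. v \<bullet> g (z + \<mu> *\<^sub>R u))"
    by (intro integrable_inner_right impI integrable_shifted_gradient)
  have shift: "z + \<mu> *\<^sub>R u + v = (z + v) + \<mu> *\<^sub>R u" for u by simp
  have "smooth_f (z + v) - smooth_f z - v \<bullet> smooth_g z
      = (\<integral>u. f ((z + \<mu> *\<^sub>R u) + v) - f (z + \<mu> *\<^sub>R u) - v \<bullet> g (z + \<mu> *\<^sub>R u) \<partial>gauss)"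
    using integrable_shifted_objective[of "z + v"] integrable_shifted_objective[of z] i
    unfolding shift by (simp add: smooth_f_def inner_smooth_g inner_commute[of v])
  also have "\<bar>\<dots>\<bar> \<le> (\<integral>u. L1 * (opnorm T v)\<^sup>2 \<partial>gauss)"
  proof (rule order_trans[OF integral_abs_bound integral_mono])
    show "integrable gauss (\<lambda>u. \<bar>f ((z + \<mu> *\<^sub>R u) + v) - f (z + \<mu> *\<^sub>R u) - v \<bullet> g (z + \<mu> *\<^sub>R u)\<bar>)"
      using integrable_shifted_objective[of "z + v"] integrable_shifted_objective[of z] i
      unfolding shift by (intro integrable_abs Bochner_Integration.integrable_diff)
  qed (auto simp: second_order_bound)
  also have "\<dots> = L1 * (opnorm T v)\<^sup>2" using gauss.prob_space by simp
  also have "\<dots> \<le> L1 * (L * (norm v)\<^sup>2)"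
    using L1_pos by (intro mult_left_mono opnorm_le_norm) simp
  finally show "\<bar>smooth_f (z + v) - smooth_f z - v \<bullet> smooth_g z\<bar> \<le> (L1 * L) * (norm v)\<^sup>2"
    by simp
qed

text \<open>The difference is paired with a test vector, the integral is taken outside, and the
  Lipschitz bound is applied to each shift by the same \<open>u\<close>.\<close>

lemma smooth_g_lipschitz: "opnorm A (smooth_g v - smooth_g w) \<le> L1 * opnorm T (v - w)"
proof (rule dual_norm_leI)
  fix x
  have i: "integrable gauss (\<lambda>u. g (z + \<mu> *\<^sub>R u) \<bullet> x)" for z
    by (intro integrable_inner_left impI integrable_shifted_gradient)
  have "(smooth_g v - smooth_g w) \<bullet> x = (\<integral>u. (g (v + \<mu> *\<^sub>R u) - g (w + \<mu> *\<^sub>R u)) \<bullet> x \<partial>gauss)"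
    using i[of v] i[of w] by (simp add: inner_diff_left inner_smooth_g)
  also have "\<dots> \<le> (\<integral>u. L1 * opnorm T (v - w) * opnorm T x \<partial>gauss)"
  proof (rule integral_mono)
    show "integrable gauss (\<lambda>u. (g (v + \<mu> *\<^sub>R u) - g (w + \<mu> *\<^sub>R u)) \<bullet> x)"
      using i[of v] i[of w] by (simp add: inner_diff_left)
    fix u
    have "(g (v + \<mu> *\<^sub>R u) - g (w + \<mu> *\<^sub>R u)) \<bullet> x
        \<le> opnorm A (g (v + \<mu> *\<^sub>R u) - g (w + \<mu> *\<^sub>R u)) * opnorm T x"
      by (rule dual_Cauchy_Schwarz)
    also have "\<dots> \<le> L1 * opnorm T (v - w) * opnorm T x"
      using lip[of "v + \<mu> *\<^sub>R u" "w + \<mu> *\<^sub>R u"] by (intro mult_right_mono) auto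
    finally show "(g (v + \<mu> *\<^sub>R u) - g (w + \<mu> *\<^sub>R u)) \<bullet> x \<le> L1 * opnorm T (v - w) * opnorm T x" .
  qed simp
  also have "\<dots> = L1 * opnorm T (v - w) * opnorm T x" using gauss.prob_space by simp
  finally show "(smooth_g v - smooth_g w) \<bullet> x \<le> L1 * opnorm T (v - w) * opnorm T x" .
qed (use L1_pos in simp)

lemma smooth_g_bias: "opnorm A (smooth_g z - g z) \<le> \<mu> * L1 * (real DIM('a) + 3) powr (3 / 2) / 2"
proof -
  have "opnorm A (smooth_g z - g z) \<le> \<mu> * L1 * (\<integral>u. opnorm T u \<partial>gauss)"
  proof (rule dual_norm_leI)
    fix x
    have i: "integrable gauss (\<lambda>u. g (z + \<mu> *\<^sub>R u) \<bullet> x)"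
      by (intro integrable_inner_left impI integrable_shifted_gradient)
    have "(smooth_g z - g z) \<bullet> x = (\<integral>u. (g (z + \<mu> *\<^sub>R u) - g z) \<bullet> x \<partial>gauss)"
      using i gauss.prob_space by (simp add: inner_diff_left inner_smooth_g)
    also have "\<dots> \<le> (\<integral>u. \<mu> * L1 * opnorm T u * opnorm T x \<partial>gauss)"
    proof (rule integral_mono)
      show "integrable gauss (\<lambda>u. (g (z + \<mu> *\<^sub>R u) - g z) \<bullet> x)"
        using i by (simp add: inner_diff_left)
      show "integrable gauss (\<lambda>u. \<mu> * L1 * opnorm T u * opnorm T x)"
        using opnorm_first_moment(1) by auto
      fix u
      have "(g (z + \<mu> *\<^sub>R u) - g z) \<bullet> x \<le> opnorm A (g (z + \<mu> *\<^sub>R u) - g z) * opnorm T x"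
        by (rule dual_Cauchy_Schwarz)
      also have "\<dots> \<le> \<mu> * L1 * opnorm T u * opnorm T x"
        using lip[of "z + \<mu> *\<^sub>R u" z] \<mu>_pos
        by (intro mult_right_mono) (auto simp: opnorm_scale ac_simps)
      finally show "(g (z + \<mu> *\<^sub>R u) - g z) \<bullet> x \<le> \<mu> * L1 * opnorm T u * opnorm T x" .
    qed
    also have "\<dots> = \<mu> * L1 * (\<integral>u. opnorm T u \<partial>gauss) * opnorm T x"
      by simp
    finally show "(smooth_g z - g z) \<bullet> x \<le> \<mu> * L1 * (\<integral>u. opnorm T u \<partial>gauss) * opnorm T x" .
  qed (use \<mu>_pos L1_pos in \<open>auto intro!: mult_nonneg_nonneg integral_nonneg\<close>)
  also have "\<dots> \<le> \<mu> * L1 * ((real DIM('a) + 3) powr (3 / 2) / 2)"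
  proof (rule mult_left_mono)
    \<comment> \<open>Since \<open>t\<close> is at least 4, \<open>sqrt t\<close> is at least 2,
      hence \<open>t \<le> t powr (3 / 2) / 2\<close>; this leaves room for the first moment bound
      of dimension plus 3/2.\<close>
    define t where "t = real DIM('a) + 3"
    have t: "t \<ge> 4" using DIM_positive[where 'a = 'a] by (simp add: t_def)
    have "t * 2 \<le> t * sqrt t" using t real_le_rsqrt[of 2 t] by (intro mult_left_mono) auto
    also have "t * sqrt t = t powr (3 / 2)"
      using t powr_add[of t 1 "1/2"] by (simp add: powr_half_sqrt)
    finally show "(\<integral>u. opnorm T u \<partial>gauss) \<le> (real DIM('a) + 3) powr (3 / 2) / 2"
      using opnorm_first_moment(2) t by (simp add: t_def)
  qed (use \<mu>_pos L1_pos in simp)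
  finally show ?thesis by simp
qed

end

subsection \<open>One step of the extragradient method\<close>

definition op_residual :: "('a::real_inner \<Rightarrow> 'a) \<Rightarrow> 'a set \<Rightarrow> 'a \<Rightarrow> real \<Rightarrow> 'a \<Rightarrow> 'a" where
  "op_residual T Z w h v = (1 / h) *\<^sub>R (w - op_proj T Z (w - h *\<^sub>R v))"

text \<open>Weighted Cauchy-Schwarz: the reciprocals of the weights 2, 4, 4 add up to one. The small
  weight goes to the Lipschitz term, which must be absorbed; the others go to the noise.\<close>

lemma sum3_sq_le: "(x + y + z)\<^sup>2 \<le> 2 * y\<^sup>2 + 4 * x\<^sup>2 + 4 * (z::real)\<^sup>2"
proof -
  have "0 \<le> (x - z)\<^sup>2 * 2 + (x + z - y)\<^sup>2" by simp
  then show ?thesis by (simp add: power2_eq_square algebra_simps)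
qed

lemma sum4_sq_le: "(x + y + z + w)\<^sup>2 \<le> 4 * (x\<^sup>2 + y\<^sup>2 + z\<^sup>2 + (w::real)\<^sup>2)"
proof -
  have "0 \<le> (x - y)\<^sup>2 + (x - z)\<^sup>2 + (x - w)\<^sup>2 + (y - z)\<^sup>2 + (y - w)\<^sup>2 + (z - w)\<^sup>2" by simp
  then show ?thesis by (simp add: power2_eq_square algebra_simps)
qed

text \<open>The isometry \<open>J\<close> is the sign change of the second block that turns a gradient into the
  saddle operator.\<close>

locale saddle_problem = smooth_objective T A l L c f g L1 \<mu>
  for T A :: "'a::euclidean_space \<Rightarrow> 'a" and l L c f g L1 \<mu> +
  fixes J :: "'a \<Rightarrow> 'a" and Z :: "'a set" and \<kappa> D b :: real
  assumes J_linear: "linear J" and norm_J: "norm (J v) = norm v"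
    and dual_J: "opnorm A (J v) = opnorm A v"
    and Z: "compact Z" "convex Z" "Z \<noteq> {}"
    and diameter: "v \<in> Z \<Longrightarrow> w \<in> Z \<Longrightarrow> opnorm T (v - w) \<le> D"
    and \<kappa>_def: "\<kappa> = L / l"
    and bias: "opnorm A (smooth_g v - g v) \<le> b"
begin

definition estimator :: "'a \<Rightarrow> 'a \<Rightarrow> 'a" where
  "estimator z u = ((f (z + \<mu> *\<^sub>R u) - f z) / \<mu>) *\<^sub>R J (T u)"

definition noise :: "'a \<Rightarrow> 'a \<Rightarrow> real" where
  "noise z u = opnorm A (estimator z u - J (smooth_g z))"

lemma noise_nonneg [simp]: "0 \<le> noise z u"
  by (simp add: noise_def)

lemma \<kappa>_ge_1: "1 \<le> \<kappa>"
  using l_pos l_le_L by (simp add: \<kappa>_def)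

lemma l_\<kappa>: "l * \<kappa> = L"
  using l_pos by (simp add: \<kappa>_def)

lemma proj_in: "op_proj T Z w \<in> Z"
  by (rule op_proj_in[OF Z])

lemma D_nonneg: "0 \<le> D"
  using diameter[OF proj_in proj_in, of 0 0] opnorm_nonneg order_trans by blast

lemma b_nonneg: "0 \<le> b"
  using bias[of 0] dual.opnorm_nonneg order_trans by blast

lemma dual_J_diff: "opnorm A (J v - J w) = opnorm A (v - w)"
  by (simp add: dual_J flip: linear_diff[OF J_linear])

lemma residual_nonexpansive:
  assumes "h > 0"
  shows "opnorm T (op_residual T Z w h v - op_residual T Z w h v') \<le> opnorm T (v - v')"
proof -
  have "op_residual T Z w h v - op_residual T Z w h v'
      = (1 / h) *\<^sub>R (op_proj T Z (w - h *\<^sub>R v') - op_proj T Z (w - h *\<^sub>R v))"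
    by (simp add: op_residual_def flip: scaleR_diff_right)
  moreover have "opnorm T (op_proj T Z (w - h *\<^sub>R v') - op_proj T Z (w - h *\<^sub>R v)) \<le> opnorm T (h *\<^sub>R (v - v'))"
    using op_proj_nonexpansive[OF Z, of "w - h *\<^sub>R v'" "w - h *\<^sub>R v"] by (simp add: scaleR_diff_right)
  ultimately show ?thesis using assms by (simp only: opnorm_scale) (simp add: field_simps)
qed

text \<open>Nonexpansiveness lives in the primal norm, while the Minty term and the errors are
  measured in the dual one. Changing norms on both sides costs \<open>L / l\<close>.\<close>

lemma residual_dual_lipschitz:
  assumes "h > 0"
  shows "opnorm A (op_residual T Z w h v - op_residual T Z w h v') \<le> \<kappa> * opnorm A (v - v')"
proof -
  have "l * opnorm A (op_residual T Z w h v - op_residual T Z w h v')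
      \<le> opnorm T (op_residual T Z w h v - op_residual T Z w h v')"
    by (rule dual_le_opnorm)
  also have "\<dots> \<le> opnorm T (v - v')" by (rule residual_nonexpansive[OF assms])
  also have "\<dots> \<le> L * opnorm A (v - v')" by (rule opnorm_le_dual)
  finally show ?thesis using l_pos by (simp add: \<kappa>_def field_simps)
qed

text \<open>The descent inequality holds pointwise: noise and bias stay as explicit quantities, to
  be averaged later. Its left coefficient is what remains of the quadratic term in \<open>s\<close>
  after both absorptions.\<close>

lemma extragradient_step:
  fixes w uh u zs :: 'a and h \<rho> :: real
  defines "s \<equiv> op_residual T Z w h (estimator w uh)"
    and "v \<equiv> op_proj T Z (w - h *\<^sub>R estimator w uh)"
  defines "w' \<equiv> op_proj T Z (w - h *\<^sub>R estimator v u)"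
    and "p \<equiv> op_residual T Z w h (J (g v))"
  assumes h: "0 < h" "h \<le> 1 / (2 * L1 * \<kappa> * L)" and \<rho>: "0 \<le> \<rho>" and zs: "zs \<in> Z"
    and minty: "0 \<le> p \<bullet> (v - zs) + \<rho> / 2 * (opnorm A p)\<^sup>2"
  shows "(h\<^sup>2 / 2 - 3 * \<rho> / (L1 * l * L * \<kappa>)) * (norm s)\<^sup>2
    \<le> (norm (w - zs))\<^sup>2 - (norm (w' - zs))\<^sup>2
      + 4 * h\<^sup>2 * L * \<kappa> * ((noise w uh)\<^sup>2 + (noise v u)\<^sup>2)
      + 4 * h * \<rho> * \<kappa>\<^sup>2 * ((noise w uh)\<^sup>2 + b\<^sup>2) + 2 * h * \<kappa> * D * (noise v u + b)"
proof -
  define s2 where "s2 = op_residual T Z w h (estimator v u)"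
  define n1 where "n1 = noise w uh"
  define n2 where "n2 = noise v u"
  define \<delta> where "\<delta> = opnorm T (w - v)"
  \<comment> \<open>Normalised step size: the upper bound on \<open>h\<close> says exactly that
    \<open>q\<close> is at most 1/2.\<close>
  define q where "q = h * L1 * \<kappa> * L"
  have q: "0 \<le> q" "q \<le> 1 / 2"
    using h L1_pos L_pos \<kappa>_ge_1 by (simp_all add: q_def field_simps)
  have hs: "v = w - h *\<^sub>R s" "w' = w - h *\<^sub>R s2"
    using h by (simp_all add: s_def v_def w'_def s2_def op_residual_def)
  have \<delta>: "0 \<le> \<delta>" "\<delta>\<^sup>2 \<le> h\<^sup>2 * (L * (norm s)\<^sup>2)"
    using opnorm_le_norm[of s] h by (simp_all add: \<delta>_def hs opnorm_scale power_mult_distrib)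
  have n_nonneg: "0 \<le> n1" "0 \<le> n2" by (simp_all add: n1_def n2_def)
  have b0: "0 \<le> b" and D0: "0 \<le> D" and k0: "0 \<le> \<kappa>"
    using b_nonneg D_nonneg \<kappa>_ge_1 by auto

  \<comment> \<open>Each estimate is compared with the smoothed operator at its own point; the two
    points are then linked by the Lipschitz constant.\<close>
  have "opnorm A (estimator w uh - estimator v u)
      = opnorm A ((estimator w uh - J (smooth_g w)) + (J (smooth_g w) - J (smooth_g v)) + (J (smooth_g v) - estimator v u))"
    by simp
  also have "\<dots> \<le> n1 + L1 * \<delta> + n2"
    unfolding n1_def n2_def noise_def \<delta>_def
    using smooth_g_lipschitz[of w v] dual.opnorm_minus_commute[of "J (smooth_g v)" "estimator v u"]
    by (intro dual.opnorm_triangle[THEN order_trans] add_mono) (simp_all add: dual_J_diff)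
  finally have G: "opnorm A (estimator w uh - estimator v u) \<le> n1 + L1 * \<delta> + n2" .
  have "l * (norm (s - s2))\<^sup>2 \<le> (opnorm T (s - s2))\<^sup>2" by (rule norm_le_opnorm)
  also have "\<dots> \<le> (L * (n1 + L1 * \<delta> + n2))\<^sup>2"
    unfolding s_def s2_def using G L_pos
    by (intro power_mono opnorm_nonneg order_trans[OF residual_nonexpansive[OF h(1)] order_trans[OF opnorm_le_dual]]) auto
  also have "\<dots> = l * (L * \<kappa> * (n1 + L1 * \<delta> + n2)\<^sup>2)"
    by (simp add: power_mult_distrib power2_eq_square flip: l_\<kappa>)
  finally have "(norm (s - s2))\<^sup>2 \<le> L * \<kappa> * (n1 + L1 * \<delta> + n2)\<^sup>2"
    using l_pos by simp
  also have "\<dots> \<le> L * \<kappa> * (2 * (L1 * \<delta>)\<^sup>2 + 4 * n1\<^sup>2 + 4 * n2\<^sup>2)"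
    using L_pos k0 by (intro mult_left_mono sum3_sq_le) auto
  also have "\<dots> = 2 * (L * \<kappa> * L1\<^sup>2) * \<delta>\<^sup>2 + 4 * L * \<kappa> * (n1\<^sup>2 + n2\<^sup>2)"
    by (simp add: algebra_simps power_mult_distrib)
  also have "\<dots> \<le> 2 * (L * \<kappa> * L1\<^sup>2) * (h\<^sup>2 * (L * (norm s)\<^sup>2)) + 4 * L * \<kappa> * (n1\<^sup>2 + n2\<^sup>2)"
    using L_pos k0 by (intro add_right_mono mult_left_mono \<delta>) auto
  \<comment> \<open>The factor equals \<open>2 * q\<^sup>2 / \<kappa>\<close>, at most 1/2. After
    multiplication by \<open>h\<^sup>2\<close> it uses up half of the negative quadratic term in
    \<open>s\<close>.\<close>
  also have "2 * (L * \<kappa> * L1\<^sup>2) * (h\<^sup>2 * (L * (norm s)\<^sup>2)) \<le> (norm s)\<^sup>2 / 2"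
  proof -
    have "2 * (L * \<kappa> * L1\<^sup>2) * (h\<^sup>2 * L) = 2 * q\<^sup>2 / \<kappa>"
      using \<kappa>_ge_1 by (simp add: q_def power2_eq_square field_simps)
    also have "\<dots> \<le> 2 * q\<^sup>2" using \<kappa>_ge_1 by (simp add: field_simps mult_le_cancel_right1)
    also have "\<dots> \<le> 2 * (1 / 2)\<^sup>2" using q by (intro mult_left_mono power_mono) auto
    finally have "2 * (L * \<kappa> * L1\<^sup>2) * (h\<^sup>2 * L) \<le> 1 / 2" by (simp add: power2_eq_square)
    then have "2 * (L * \<kappa> * L1\<^sup>2) * (h\<^sup>2 * L) * (norm s)\<^sup>2 \<le> 1 / 2 * (norm s)\<^sup>2"
      by (rule mult_right_mono) simp
    then show ?thesis by (simp add: mult.assoc)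
  qed
  finally have "(norm (s - s2))\<^sup>2 \<le> (norm s)\<^sup>2 / 2 + 4 * L * \<kappa> * (n1\<^sup>2 + n2\<^sup>2)" by simp
  then have ss2: "h\<^sup>2 * (norm (s - s2))\<^sup>2 \<le> h\<^sup>2 / 2 * (norm s)\<^sup>2 + 4 * h\<^sup>2 * L * \<kappa> * (n1\<^sup>2 + n2\<^sup>2)"
    by (auto dest: mult_left_mono[where c = "h\<^sup>2"] simp: algebra_simps)

  \<comment> \<open>The exact residual \<open>p\<close> is now compared with \<open>s\<close>, in
    order to bound the weak Minty term by the quadratic term in \<open>s\<close> plus
    errors.\<close>
  have "opnorm A (J (g v) - estimator w uh)
      = opnorm A ((J (g v) - J (smooth_g v)) + (J (smooth_g v) - J (smooth_g w)) + (J (smooth_g w) - estimator w uh))"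
    by simp
  also have "\<dots> \<le> b + L1 * \<delta> + n1"
    unfolding n1_def noise_def \<delta>_def
    using smooth_g_lipschitz[of v w] bias[of v] dual.opnorm_minus_commute[of "J (smooth_g w)" "estimator w uh"]
      opnorm_minus_commute[of v w] dual.opnorm_minus_commute[of "g v" "smooth_g v"]
    by (intro dual.opnorm_triangle[THEN order_trans] add_mono) (simp_all add: dual_J_diff)
  finally have "opnorm A (p - s) \<le> \<kappa> * (b + L1 * \<delta> + n1)"
    unfolding p_def s_def
    using order_trans[OF residual_dual_lipschitz[OF h(1)] mult_left_mono[OF _ k0]] by blast
  then have "opnorm A p \<le> opnorm A s + \<kappa> * L1 * \<delta> + \<kappa> * n1 + \<kappa> * b"
    using dual.opnorm_triangle[of "p - s" s] by (simp add: algebra_simps)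
  then have "(opnorm A p)\<^sup>2 \<le> (opnorm A s + \<kappa> * L1 * \<delta> + \<kappa> * n1 + \<kappa> * b)\<^sup>2"
    by (rule power_mono) simp
  also have "\<dots> \<le> 4 * ((opnorm A s)\<^sup>2 + (\<kappa> * L1 * \<delta>)\<^sup>2 + (\<kappa> * n1)\<^sup>2 + (\<kappa> * b)\<^sup>2)"
    by (rule sum4_sq_le)
  \<comment> \<open>The Lipschitz part is a quarter of the first one, since
    \<open>q\<^sup>2 \<le> 1 / 4\<close>; together with the factor 4 the coefficient becomes
    \<open>5 / l\<close>.\<close>
  also have "\<dots> \<le> 4 * ((norm s)\<^sup>2 / l + (norm s)\<^sup>2 / (4 * l) + (\<kappa> * n1)\<^sup>2 + (\<kappa> * b)\<^sup>2)"
  proof (intro mult_left_mono add_right_mono add_mono)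
    show "(opnorm A s)\<^sup>2 \<le> (norm s)\<^sup>2 / l"
      using dual_le_norm[of s] l_pos by (simp add: field_simps)
    have "(\<kappa> * L1 * \<delta>)\<^sup>2 \<le> (\<kappa> * L1)\<^sup>2 * (h\<^sup>2 * (L * (norm s)\<^sup>2))"
      unfolding power_mult_distrib[of "\<kappa> * L1"] by (intro mult_left_mono \<delta>) simp
    also have "\<dots> = q\<^sup>2 * ((norm s)\<^sup>2 / L)"
      using L_pos by (simp add: q_def power2_eq_square field_simps)
    also have "\<dots> \<le> (1 / 2)\<^sup>2 * ((norm s)\<^sup>2 / l)"
      using q l_pos L_pos l_le_L by (intro mult_mono power_mono divide_left_mono) auto
    finally show "(\<kappa> * L1 * \<delta>)\<^sup>2 \<le> (norm s)\<^sup>2 / (4 * l)" by (simp add: power2_eq_square)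
  qed simp
  also have "\<dots> = 5 / l * (norm s)\<^sup>2 + 4 * \<kappa>\<^sup>2 * (n1\<^sup>2 + b\<^sup>2)"
    using l_pos by (simp add: power_mult_distrib field_simps)
  finally have "h * \<rho> * (opnorm A p)\<^sup>2 \<le> h * \<rho> * (5 / l * (norm s)\<^sup>2 + 4 * \<kappa>\<^sup>2 * (n1\<^sup>2 + b\<^sup>2))"
    using h \<rho> by (intro mult_left_mono) auto
  also have "\<dots> = h * (5 * \<rho> / l) * (norm s)\<^sup>2 + 4 * h * \<rho> * \<kappa>\<^sup>2 * (n1\<^sup>2 + b\<^sup>2)"
    by (simp add: algebra_simps)
  also have "h * (5 * \<rho> / l) * (norm s)\<^sup>2 \<le> 3 * \<rho> / (L1 * l * L * \<kappa>) * (norm s)\<^sup>2"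
  proof (rule mult_right_mono)
    \<comment> \<open>Enlarging 5 to 6 makes the step size bound produce exactly the amount
      subtracted in the left coefficient.\<close>
    have "h * (5 * \<rho> / l) \<le> 1 / (2 * L1 * \<kappa> * L) * (6 * \<rho> / l)"
      using h \<rho> l_pos L1_pos L_pos k0 by (intro mult_mono divide_right_mono) auto
    then show "h * (5 * \<rho> / l) \<le> 3 * \<rho> / (L1 * l * L * \<kappa>)" by (simp add: ac_simps)
  qed simp
  finally have P: "h * \<rho> * (opnorm A p)\<^sup>2
      \<le> 3 * \<rho> / (L1 * l * L * \<kappa>) * (norm s)\<^sup>2 + 4 * h * \<rho> * \<kappa>\<^sup>2 * (n1\<^sup>2 + b\<^sup>2)" by simp

  \<comment> \<open>Both operators are taken at the same point \<open>v\<close>, so only noise and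
    bias occur. The pairing with \<open>v - zs\<close> is then controlled by the diameter.\<close>
  have "opnorm A (J (g v) - estimator v u)
      = opnorm A ((J (g v) - J (smooth_g v)) + (J (smooth_g v) - estimator v u))"
    by simp
  also have "\<dots> \<le> b + n2"
    unfolding n2_def noise_def
    using bias[of v] dual.opnorm_minus_commute[of "J (smooth_g v)" "estimator v u"]
      dual.opnorm_minus_commute[of "g v" "smooth_g v"]
    by (intro dual.opnorm_triangle[THEN order_trans] add_mono) (simp_all add: dual_J_diff)
  finally have ps2: "opnorm A (p - s2) \<le> \<kappa> * (b + n2)"
    unfolding p_def s2_def
    using order_trans[OF residual_dual_lipschitz[OF h(1)] mult_left_mono[OF _ k0]] by blast
  have "(p - s2) \<bullet> (v - zs) \<le> opnorm A (p - s2) * opnorm T (v - zs)"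
    by (rule dual_Cauchy_Schwarz)
  also have "\<dots> \<le> (\<kappa> * (b + n2)) * D"
    using ps2 zs b0 n_nonneg k0 unfolding v_def
    by (intro mult_mono diameter proj_in) auto
  finally have "p \<bullet> (v - zs) - s2 \<bullet> (v - zs) \<le> \<kappa> * D * (n2 + b)"
    by (simp add: inner_diff_left ac_simps)
  then have "- (s2 \<bullet> (v - zs)) \<le> \<rho> / 2 * (opnorm A p)\<^sup>2 + \<kappa> * D * (n2 + b)"
    using minty by linarith
  then have "(2 * h) * (- (s2 \<bullet> (v - zs))) \<le> (2 * h) * (\<rho> / 2 * (opnorm A p)\<^sup>2 + \<kappa> * D * (n2 + b))"
    using h by (intro mult_left_mono) auto
  then have I: "- 2 * h * (s2 \<bullet> (v - zs)) \<le> h * \<rho> * (opnorm A p)\<^sup>2 + 2 * h * \<kappa> * D * (n2 + b)"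
    by (simp add: algebra_simps)

  \<comment> \<open>The inner product with \<open>w - zs\<close> splits as the one with
    \<open>v - zs\<close> plus \<open>h * (s2 \<bullet> s)\<close>; completing the square absorbs
    the latter.\<close>
  have "(norm (w' - zs))\<^sup>2 = (norm (w - zs))\<^sup>2 - 2 * h * (s2 \<bullet> (v - zs)) + h\<^sup>2 * (norm (s - s2))\<^sup>2 - h\<^sup>2 * (norm s)\<^sup>2"
  proof -
    define a where "a = w - zs"
    have e: "w' - zs = a - h *\<^sub>R s2" "v - zs = a - h *\<^sub>R s" by (simp_all add: hs a_def)
    show ?thesis unfolding e a_def[symmetric] power2_norm_eq_inner
      by (simp add: inner_diff_left inner_diff_right
          inner_commute power2_eq_square algebra_simps)
  qed
  with ss2 P I show ?thesis
    unfolding n1_def[symmetric] n2_def[symmetric] by (simp add: left_diff_distrib)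
qed

end

subsection \<open>Independence of iterates and fresh samples\<close>

text \<open>This takes the place of conditioning on the past: the joint law of past and fresh sample
  is a product, so by Fubini the bound for each frozen \<open>y\<close> may be used first.
  Nonnegative integrals require no prior integrability.\<close>

lemma (in prob_space) nn_integral_indep_le:
  fixes X :: "'i \<Rightarrow> 'a \<Rightarrow> 'b::topological_space" and n :: "'b \<times> 'b \<Rightarrow> ennreal"
  assumes indep: "indep_vars (\<lambda>_. borel) X UNIV" and j: "j \<notin> I"
    and \<Phi> [measurable]: "\<Phi> \<in> measurable (PiM I (\<lambda>_. borel)) borel"
    and Y: "\<And>\<omega>. \<omega> \<in> space M \<Longrightarrow> Y \<omega> = \<Phi> (\<lambda>i\<in>I. X i \<omega>)"
    and n [measurable]: "n \<in> borel_measurable (borel \<Otimes>\<^sub>M borel)"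
    and bound: "\<And>y. (\<integral>\<^sup>+v. n (y, v) \<partial>distr M borel (X j)) \<le> K"
  shows "(\<integral>\<^sup>+\<omega>. n (Y \<omega>, X j \<omega>) \<partial>M) \<le> K"
proof -
  \<comment> \<open>\<open>Y\<close> is prescribed only on \<open>space M\<close>; \<open>Y'\<close>
    is a total version to which independence over disjoint index sets applies.\<close>
  define Y' where "Y' = (\<lambda>\<omega>. \<Phi> (\<lambda>i\<in>I. X i \<omega>))"
  have "indep_var borel (\<Phi> \<circ> (\<lambda>\<omega>. \<lambda>i\<in>I. X i \<omega>)) borel ((\<lambda>x. x j) \<circ> (\<lambda>\<omega>. \<lambda>i\<in>{j}. X i \<omega>))"
    using j by (intro indep_var_compose[OF indep_var_restrict[OF indep]]) auto
  then have "indep_var borel Y' borel (X j)" by (simp add: comp_def Y'_def)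
  then have Y' [measurable]: "Y' \<in> borel_measurable M" and X [measurable]: "X j \<in> borel_measurable M"
    and joint: "distr M borel Y' \<Otimes>\<^sub>M distr M borel (X j) = distr M (borel \<Otimes>\<^sub>M borel) (\<lambda>\<omega>. (Y' \<omega>, X j \<omega>))"
    unfolding indep_var_distribution_eq by auto
  interpret Xj: prob_space "distr M borel (X j)" by (rule prob_space_distr) measurable
  interpret SY: prob_space "distr M borel Y'" by (rule prob_space_distr) measurable
  have "(\<integral>\<^sup>+\<omega>. n (Y \<omega>, X j \<omega>) \<partial>M) = (\<integral>\<^sup>+\<omega>. n (Y' \<omega>, X j \<omega>) \<partial>M)"
    by (intro nn_integral_cong) (simp add: Y Y'_def)
  also have "\<dots> = (\<integral>\<^sup>+x. n x \<partial>distr M (borel \<Otimes>\<^sub>M borel) (\<lambda>\<omega>. (Y' \<omega>, X j \<omega>)))"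
    by (subst nn_integral_distr) simp_all
  also have "\<dots> = (\<integral>\<^sup>+y. \<integral>\<^sup>+v. n (y, v) \<partial>distr M borel (X j) \<partial>distr M borel Y')"
    unfolding joint[symmetric] by (subst Xj.nn_integral_fst) simp_all
  also have "\<dots> \<le> (\<integral>\<^sup>+y. K \<partial>distr M borel Y')"
    by (intro nn_integral_mono bound)
  also have "\<dots> = K" using SY.emeasure_space_1 by simp
  finally show ?thesis .
qed

text \<open>Nonnegativity of the variance. It handles the noise that occurs to first power beside
  the diameter.\<close>

lemma (in prob_space) expectation_le_of_square:
  fixes X :: "'a \<Rightarrow> real"
  assumes X [measurable]: "X \<in> borel_measurable M" and sq: "integrable M (\<lambda>\<omega>. (X \<omega>)\<^sup>2)"
    and le: "expectation (\<lambda>\<omega>. (X \<omega>)\<^sup>2) \<le> \<sigma>\<^sup>2" and \<sigma>: "0 \<le> \<sigma>"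
  shows "integrable M X" and "expectation X \<le> \<sigma>"
proof -
  show i: "integrable M X" using square_integrable_imp_integrable[OF X sq] .
  have "(expectation X)\<^sup>2 \<le> \<sigma>\<^sup>2"
    using variance_positive[of X] variance_eq[OF i sq] le by simp
  then show "expectation X \<le> \<sigma>" using \<sigma> by (rule power2_le_imp_le)
qed

section \<open>Measurability and square integrability of the noise\<close>

context saddle_problem
begin

lemma proj_measurable [measurable]: "op_proj T Z \<in> borel_measurable borel"
  by (intro borel_measurable_continuous_onI continuous_on_op_proj Z)

lemma J_measurable [measurable]: "J \<in> borel_measurable borel"
  using J_linear by (intro borel_measurable_continuous_onI linear_continuous_on) (simp add: linear_conv_bounded_linear)

lemma dual_norm_measurable [measurable]: "opnorm A \<in> borel_measurable borel"
  by (intro borel_measurable_continuous_onI dual.continuous_on_opnorm continuous_intros)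

text \<open>The smoothed function satisfies the hypotheses imposed on \<open>f\<close>, so
  continuity of its gradient is inherited by interpreting the same locale again.\<close>

lemma smooth_g_measurable [measurable]: "smooth_g \<in> borel_measurable borel"
proof -
  interpret S: smooth_objective T A l L c smooth_f smooth_g L1 \<mu>
    by unfold_locales (auto simp: GDERIV_smooth smooth_g_lipschitz L1_pos \<mu>_pos)
  show ?thesis by (rule S.gradient_measurable)
qed

lemma estimator_measurable [measurable (raw)]:
  assumes [measurable]: "Y \<in> borel_measurable N" "U \<in> borel_measurable N"
  shows "(\<lambda>x. estimator (Y x) (U x)) \<in> borel_measurable N"
  unfolding estimator_def by measurable

lemma noise_measurable [measurable (raw)]:
  assumes [measurable]: "Y \<in> borel_measurable N" "U \<in> borel_measurable N"
  shows "(\<lambda>x. noise (Y x) (U x)) \<in> borel_measurable N"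
  unfolding noise_def by measurable

lemma norm_T_le: "norm (T u) \<le> L * norm u"
proof (rule power2_le_imp_le)
  have "(norm (T u))\<^sup>2 \<le> L * (opnorm A (T u))\<^sup>2" by (rule norm_le_dual)
  also have "(opnorm A (T u))\<^sup>2 = (opnorm T u)\<^sup>2" by (simp add: dual.opnorm_sq opnorm_sq inner_commute)
  also have "L * (opnorm T u)\<^sup>2 \<le> L * (L * (norm u)\<^sup>2)"
    using L_pos by (intro mult_left_mono opnorm_le_norm) simp
  finally show "(norm (T u))\<^sup>2 \<le> (L * norm u)\<^sup>2" by (simp add: power2_eq_square ac_simps)
qed (use L_pos in simp)

text \<open>A Bochner integral is 0 for a nonintegrable function, so the variance hypothesis has
  content only once this is known. The estimator grows cubically in \<open>u\<close>.\<close>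

lemma integrable_noise_sq: "integrable gauss (\<lambda>u. (noise z u)\<^sup>2)"
proof -
  obtain C where C: "C \<ge> 0" "\<And>u. \<bar>f (z + \<mu> *\<^sub>R u) - f z\<bar> \<le> C * (1 + norm u)\<^sup>2"
    using increment_growth by blast
  define K where "K = C / \<mu> * L + norm (smooth_g z)"
  show ?thesis
  proof (rule integrable_poly_growth[where C = "K\<^sup>2 / l"])
    show "(\<lambda>u. (noise z u)\<^sup>2) \<in> borel_measurable borel"
      unfolding noise_def estimator_def by measurable
    fix u :: 'a
    define t where "t = 1 + norm u"
    have t: "1 \<le> t" by (simp add: t_def)
    have "norm (estimator z u) = \<bar>f (z + \<mu> *\<^sub>R u) - f z\<bar> / \<mu> * norm (T u)"
      using \<mu>_pos by (simp add: estimator_def norm_J)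
    also have "\<dots> \<le> (C * t\<^sup>2) / \<mu> * (L * t)"
      using C \<mu>_pos L_pos unfolding t_def
      by (intro mult_mono divide_right_mono order_trans[OF norm_T_le]) auto
    also have "\<dots> = C / \<mu> * L * t ^ 3" by (simp add: power2_eq_square power3_eq_cube)
    finally have "norm (estimator z u - J (smooth_g z)) \<le> C / \<mu> * L * t ^ 3 + norm (smooth_g z) * 1"
      using norm_triangle_ineq4[of "estimator z u" "J (smooth_g z)"] by (simp add: norm_J)
    also have "\<dots> \<le> C / \<mu> * L * t ^ 3 + norm (smooth_g z) * t ^ 3"
      using t by (intro add_left_mono mult_left_mono one_le_power) auto
    finally have "norm (estimator z u - J (smooth_g z)) \<le> K * t ^ 3" by (simp add: K_def algebra_simps)
    then have "(norm (estimator z u - J (smooth_g z)))\<^sup>2 \<le> (K * t ^ 3)\<^sup>2" by (rule power_mono) simp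
    then have "l * (noise z u)\<^sup>2 \<le> K\<^sup>2 * t ^ 6"
      using dual_le_norm[of "estimator z u - J (smooth_g z)"]
      by (simp add: noise_def power_mult_distrib flip: power_mult)
    then show "norm ((noise z u)\<^sup>2) \<le> K\<^sup>2 / l * (1 + norm u) ^ 6"
      using l_pos by (simp add: t_def[symmetric] field_simps)
  qed
qed

subsection \<open>Convergence in expectation\<close>

text \<open>The pointwise descent inequality is integrated and telescoped. The coefficient 8
  collects the second moments of the two noises, each entering with 4.\<close>

theorem extragradient_expectation_bound:
  fixes M :: "'w measure" and uh u z zh s :: "nat \<Rightarrow> 'w \<Rightarrow> 'a" and h \<rho> \<sigma> :: real and zs z0 :: 'a
  assumes M: "prob_space M"
    and indep: "prob_space.indep_vars M (\<lambda>_. borel) (case_sum uh u) UNIV"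
    and law: "\<And>k. distr M borel (uh k) = gauss" "\<And>k. distr M borel (u k) = gauss"
    and z_0: "\<And>\<omega>. \<omega> \<in> space M \<Longrightarrow> z 0 \<omega> = z0"
    and zh: "\<And>k \<omega>. \<omega> \<in> space M \<Longrightarrow> zh k \<omega> = op_proj T Z (z k \<omega> - h *\<^sub>R estimator (z k \<omega>) (uh k \<omega>))"
    and z_Suc: "\<And>k \<omega>. \<omega> \<in> space M \<Longrightarrow> z (Suc k) \<omega> = op_proj T Z (z k \<omega> - h *\<^sub>R estimator (zh k \<omega>) (u k \<omega>))"
    and s: "\<And>k \<omega>. \<omega> \<in> space M \<Longrightarrow> s k \<omega> = op_residual T Z (z k \<omega>) h (estimator (z k \<omega>) (uh k \<omega>))"
    and z0: "z0 \<in> Z" and zs: "zs \<in> Z"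
    and h: "0 < h" "h \<le> 1 / (2 * L1 * \<kappa> * L)" and \<rho>: "0 \<le> \<rho>" and \<sigma>: "0 \<le> \<sigma>"
    and minty: "\<And>w v. w \<in> Z \<Longrightarrow> v \<in> Z \<Longrightarrow> 0 \<le> op_residual T Z w h (J (g v)) \<bullet> (v - zs)
        + \<rho> / 2 * (opnorm A (op_residual T Z w h (J (g v))))\<^sup>2"
    and variance: "\<And>w. (\<integral>v. (noise w v)\<^sup>2 \<partial>gauss) \<le> \<sigma>\<^sup>2"
  shows "(h\<^sup>2 / 2 - 3 * \<rho> / (L1 * l * L * \<kappa>)) * (\<Sum>k=0..N. \<integral>\<omega>. (norm (s k \<omega>))\<^sup>2 \<partial>M)
    \<le> (norm (z0 - zs))\<^sup>2 + (real N + 1) * (8 * h\<^sup>2 * L * \<kappa> * \<sigma>\<^sup>2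
      + 4 * h * \<rho> * \<kappa>\<^sup>2 * (\<sigma>\<^sup>2 + b\<^sup>2) + 2 * h * \<kappa> * D * (\<sigma> + b))"
proof -
  interpret M: prob_space M by (rule M)
  define X where "X = case_sum uh u"
  \<comment> \<open>Index set of the samples drawn before iteration \<open>k\<close>:
    \<open>z k\<close> depends on \<open>I k\<close> only, while \<open>zh k\<close> also uses
    \<open>Inl k\<close>, and the sample \<open>Inr k\<close> is still fresh.\<close>
  define I where "I k = Inl ` {..<k} \<union> Inr ` {..<k}" for k :: nat
  have X_simps: "X (Inl k) = uh k" "X (Inr k) = u k" for k by (simp_all add: X_def)
  have indepX: "M.indep_vars (\<lambda>_. borel) X UNIV" unfolding X_def by (rule indep)
  then have X_meas: "X i \<in> borel_measurable M" for i unfolding M.indep_vars_def by simp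
  then have uh_meas [measurable]: "uh k \<in> borel_measurable M" and u_meas [measurable]: "u k \<in> borel_measurable M" for k
    using X_meas[of "Inl k"] X_meas[of "Inr k"] by (simp_all add: X_simps)
  have X_law: "distr M borel (X i) = gauss" for i
    using law by (cases i) (simp_all add: X_simps)

  \<comment> \<open>Measurability on \<open>M\<close> alone would not do: independence needs the
    iterate as a measurable function of the past coordinates.\<close>
  have zh_past: "\<exists>\<Psi>\<in>measurable (PiM (insert (Inl k) (I k)) (\<lambda>_. borel)) borel.
      \<forall>\<omega>\<in>space M. zh k \<omega> = \<Psi> (\<lambda>i\<in>insert (Inl k) (I k). X i \<omega>)"
    if \<Phi>: "\<Phi> \<in> measurable (PiM (I k) (\<lambda>_. borel)) borel" "\<forall>\<omega>\<in>space M. z k \<omega> = \<Phi> (\<lambda>i\<in>I k. X i \<omega>)"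
    for k \<Phi>
  proof (intro bexI ballI)
    let ?J = "insert (Inl k) (I k)"
    let ?R = "\<lambda>x. restrict x (I k)"
    have [measurable]: "?R \<in> measurable (PiM ?J (\<lambda>_. borel)) (PiM (I k) (\<lambda>_. borel))"
      by (rule measurable_restrict_subset) auto
    have [measurable]: "(\<lambda>x. x (Inl k)) \<in> measurable (PiM ?J (\<lambda>_. borel)) borel"
      by (rule measurable_component_singleton) simp
    note \<Phi>(1)[measurable]
    show "(\<lambda>x. op_proj T Z (\<Phi> (?R x) - h *\<^sub>R estimator (\<Phi> (?R x)) (x (Inl k))))
        \<in> measurable (PiM ?J (\<lambda>_. borel)) borel"
      by measurable
    show "zh k \<omega> = op_proj T Z (\<Phi> (?R (\<lambda>i\<in>?J. X i \<omega>)) - h *\<^sub>R estimator (\<Phi> (?R (\<lambda>i\<in>?J. X i \<omega>))) ((\<lambda>i\<in>?J. X i \<omega>) (Inl k)))"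
      if "\<omega> \<in> space M" for \<omega>
    proof -
      have "?R (\<lambda>i\<in>?J. X i \<omega>) = (\<lambda>i\<in>I k. X i \<omega>)" by (auto simp: restrict_def)
      then show ?thesis using \<Phi>(2) that by (simp add: zh X_simps)
    qed
  qed
  have z_past: "\<exists>\<Phi>\<in>measurable (PiM (I k) (\<lambda>_. borel)) borel. \<forall>\<omega>\<in>space M. z k \<omega> = \<Phi> (\<lambda>i\<in>I k. X i \<omega>)" for k
  proof (induction k)
    case 0
    show ?case by (intro bexI[of _ "\<lambda>_. z0"]) (auto simp: z_0)
  next
    case (Suc k)
    then obtain \<Phi> where \<Phi>: "\<Phi> \<in> measurable (PiM (I k) (\<lambda>_. borel)) borel"
      "\<forall>\<omega>\<in>space M. z k \<omega> = \<Phi> (\<lambda>i\<in>I k. X i \<omega>)" by blast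
    from zh_past[OF this] obtain \<Psi> where
      \<Psi>: "\<Psi> \<in> measurable (PiM (insert (Inl k) (I k)) (\<lambda>_. borel)) borel"
      "\<forall>\<omega>\<in>space M. zh k \<omega> = \<Psi> (\<lambda>i\<in>insert (Inl k) (I k). X i \<omega>)" by blast
    let ?R = "\<lambda>x. restrict x (I k)" and ?R' = "\<lambda>x. restrict x (insert (Inl k) (I k))"
    show ?case
    proof (intro bexI ballI)
      have sub: "I k \<subseteq> I (Suc k)" "insert (Inl k) (I k) \<subseteq> I (Suc k)" "Inr k \<in> I (Suc k)"
        by (auto simp: I_def)
      have [measurable]: "?R \<in> measurable (PiM (I (Suc k)) (\<lambda>_. borel)) (PiM (I k) (\<lambda>_. borel))"
        "?R' \<in> measurable (PiM (I (Suc k)) (\<lambda>_. borel)) (PiM (insert (Inl k) (I k)) (\<lambda>_. borel))"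
        by (rule measurable_restrict_subset, rule sub)+
      have [measurable]: "(\<lambda>x. x (Inr k)) \<in> measurable (PiM (I (Suc k)) (\<lambda>_. borel)) borel"
        by (rule measurable_component_singleton) (rule sub)
      note \<Phi>(1)[measurable] \<Psi>(1)[measurable]
      show "(\<lambda>x. op_proj T Z (\<Phi> (?R x) - h *\<^sub>R estimator (\<Psi> (?R' x)) (x (Inr k))))
          \<in> measurable (PiM (I (Suc k)) (\<lambda>_. borel)) borel"
        by measurable
      fix \<omega> assume \<omega>: "\<omega> \<in> space M"
      let ?x = "\<lambda>i\<in>I (Suc k). X i \<omega>"
      have "?R ?x = (\<lambda>i\<in>I k. X i \<omega>)" "?R' ?x = (\<lambda>i\<in>insert (Inl k) (I k). X i \<omega>)"
        using sub by (auto simp: restrict_def fun_eq_iff)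
      then show "z (Suc k) \<omega> = op_proj T Z (\<Phi> (?R ?x) - h *\<^sub>R estimator (\<Psi> (?R' ?x)) (?x (Inr k)))"
        using \<Phi>(2) \<Psi>(2) \<omega> sub(3) by (simp add: z_Suc X_simps)
    qed
  qed

  have past_meas: "Y \<in> borel_measurable M"
    if "\<Phi> \<in> measurable (PiM K (\<lambda>_. borel)) borel" "\<forall>\<omega>\<in>space M. Y \<omega> = \<Phi> (\<lambda>i\<in>K. X i \<omega>)" for K \<Phi> and Y :: "'w \<Rightarrow> 'a"
  proof (subst measurable_cong)
    show "Y \<omega> = \<Phi> (\<lambda>i\<in>K. X i \<omega>)" if "\<omega> \<in> space M" for \<omega>
      using \<open>\<forall>\<omega>\<in>space M. Y \<omega> = \<Phi> (\<lambda>i\<in>K. X i \<omega>)\<close> that by blast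
    show "(\<lambda>\<omega>. \<Phi> (\<lambda>i\<in>K. X i \<omega>)) \<in> borel_measurable M"
      by (rule measurable_compose[OF measurable_restrict that(1)]) (rule X_meas)
  qed
  have sq_bound: "integrable M (\<lambda>\<omega>. (noise (Y \<omega>) (X j \<omega>))\<^sup>2)
      \<and> (\<integral>\<omega>. (noise (Y \<omega>) (X j \<omega>))\<^sup>2 \<partial>M) \<le> \<sigma>\<^sup>2"
    if "\<Phi> \<in> measurable (PiM K (\<lambda>_. borel)) borel" "\<forall>\<omega>\<in>space M. Y \<omega> = \<Phi> (\<lambda>i\<in>K. X i \<omega>)" "j \<notin> K"
    for K \<Phi> Y j
  proof -
    note [measurable] = past_meas[OF that(1,2)] X_meas
    have meas: "(\<lambda>\<omega>. (noise (Y \<omega>) (X j \<omega>))\<^sup>2) \<in> borel_measurable M" by measurable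
    have "(\<integral>\<^sup>+v. ennreal ((noise y v)\<^sup>2) \<partial>gauss) \<le> ennreal (\<sigma>\<^sup>2)" for y
      using variance[of y] integrable_noise_sq[of y] by (simp add: nn_integral_eq_integral ennreal_leI)
    then have le: "(\<integral>\<^sup>+\<omega>. ennreal ((noise (Y \<omega>) (X j \<omega>))\<^sup>2) \<partial>M) \<le> ennreal (\<sigma>\<^sup>2)"
      using M.nn_integral_indep_le[OF indepX that(3,1), of Y "\<lambda>x. ennreal ((noise (fst x) (snd x))\<^sup>2)" "ennreal (\<sigma>\<^sup>2)"]
        that(2) by (simp add: X_law)
    then have i: "integrable M (\<lambda>\<omega>. (noise (Y \<omega>) (X j \<omega>))\<^sup>2)"
      using meas by (intro integrableI_nonneg) (auto intro: order_le_less_trans)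
    with le show ?thesis by (simp add: nn_integral_eq_integral)
  qed

  have z_meas [measurable]: "z k \<in> borel_measurable M" for k using z_past[of k] past_meas by blast
  have zh_meas [measurable]: "zh k \<in> borel_measurable M" for k
    using z_past[of k] zh_past past_meas by blast
  have n1: "integrable M (\<lambda>\<omega>. (noise (z k \<omega>) (uh k \<omega>))\<^sup>2)" "(\<integral>\<omega>. (noise (z k \<omega>) (uh k \<omega>))\<^sup>2 \<partial>M) \<le> \<sigma>\<^sup>2" for k
  proof -
    obtain \<Phi> where \<Phi>: "\<Phi> \<in> measurable (PiM (I k) (\<lambda>_. borel)) borel"
      "\<forall>\<omega>\<in>space M. z k \<omega> = \<Phi> (\<lambda>i\<in>I k. X i \<omega>)" using z_past by blast
    have "Inl k \<notin> I k" by (auto simp: I_def)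
    from sq_bound[OF \<Phi> this]
    show "integrable M (\<lambda>\<omega>. (noise (z k \<omega>) (uh k \<omega>))\<^sup>2)" "(\<integral>\<omega>. (noise (z k \<omega>) (uh k \<omega>))\<^sup>2 \<partial>M) \<le> \<sigma>\<^sup>2"
      by (simp_all add: X_simps)
  qed
  have n2: "integrable M (\<lambda>\<omega>. (noise (zh k \<omega>) (u k \<omega>))\<^sup>2)" "(\<integral>\<omega>. (noise (zh k \<omega>) (u k \<omega>))\<^sup>2 \<partial>M) \<le> \<sigma>\<^sup>2" for k
  proof -
    obtain \<Psi> where \<Psi>: "\<Psi> \<in> measurable (PiM (insert (Inl k) (I k)) (\<lambda>_. borel)) borel"
      "\<forall>\<omega>\<in>space M. zh k \<omega> = \<Psi> (\<lambda>i\<in>insert (Inl k) (I k). X i \<omega>)" using z_past zh_past by blast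
    have "Inr k \<notin> insert (Inl k) (I k)" by (auto simp: I_def)
    from sq_bound[OF \<Psi> this]
    show "integrable M (\<lambda>\<omega>. (noise (zh k \<omega>) (u k \<omega>))\<^sup>2)" "(\<integral>\<omega>. (noise (zh k \<omega>) (u k \<omega>))\<^sup>2 \<partial>M) \<le> \<sigma>\<^sup>2"
      by (simp_all add: X_simps)
  qed
  have n2': "integrable M (\<lambda>\<omega>. noise (zh k \<omega>) (u k \<omega>))" "(\<integral>\<omega>. noise (zh k \<omega>) (u k \<omega>) \<partial>M) \<le> \<sigma>" for k
    by (rule M.expectation_le_of_square[OF _ n2 \<sigma>], measurable)+

  have z_in: "z k \<omega> \<in> Z" if "\<omega> \<in> space M" for k \<omega>
    using that by (cases k) (simp_all add: z_0 z0 z_Suc proj_in)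
  \<comment> \<open>Compactness gives a uniform Euclidean bound, hence integrability of all squared
    distances and residuals.\<close>
  obtain R where R: "\<And>x y. x \<in> Z \<Longrightarrow> y \<in> Z \<Longrightarrow> norm (x - y) \<le> R"
  proof -
    obtain B where "\<forall>x\<in>Z. norm x \<le> B" using compact_imp_bounded[OF Z(1)] bounded_iff by blast
    then have "norm (x - y) \<le> B + B" if "x \<in> Z" "y \<in> Z" for x y
      using that norm_triangle_ineq4[of x y] by (meson add_mono order_trans)
    then show thesis by (rule that)
  qed
  have s_meas [measurable]: "s k \<in> borel_measurable M" for k
  proof (subst measurable_cong)
    show "s k \<omega> = op_residual T Z (z k \<omega>) h (estimator (z k \<omega>) (uh k \<omega>))" if "\<omega> \<in> space M" for \<omega>
      using that by (rule s)
    show "(\<lambda>\<omega>. op_residual T Z (z k \<omega>) h (estimator (z k \<omega>) (uh k \<omega>))) \<in> borel_measurable M"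
      unfolding op_residual_def by measurable
  qed
  have s_int: "integrable M (\<lambda>\<omega>. (norm (s k \<omega>))\<^sup>2)" for k
  proof (rule M.integrable_const_bound[where B = "(R / h)\<^sup>2"])
    have "(norm (s k \<omega>))\<^sup>2 \<le> (R / h)\<^sup>2" if "\<omega> \<in> space M" for \<omega>
      using R[OF z_in[OF that] proj_in] h(1) that
      by (intro power_mono) (simp_all add: s op_residual_def divide_right_mono)
    then show "AE \<omega> in M. norm ((norm (s k \<omega>))\<^sup>2) \<le> (R / h)\<^sup>2" by (intro AE_I2) simp
  qed measurable
  have z_int: "integrable M (\<lambda>\<omega>. (norm (z k \<omega> - zs))\<^sup>2)" for k
  proof (rule M.integrable_const_bound[where B = "R\<^sup>2"])
    have "(norm (z k \<omega> - zs))\<^sup>2 \<le> R\<^sup>2" if "\<omega> \<in> space M" for \<omega>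
      using R[OF z_in[OF that] zs] by (intro power_mono) simp_all
    then show "AE \<omega> in M. norm ((norm (z k \<omega> - zs))\<^sup>2) \<le> R\<^sup>2" by (intro AE_I2) simp
  qed measurable

  define \<alpha> where "\<alpha> = h\<^sup>2 / 2 - 3 * \<rho> / (L1 * l * L * \<kappa>)"
  define E where "E = 8 * h\<^sup>2 * L * \<kappa> * \<sigma>\<^sup>2 + 4 * h * \<rho> * \<kappa>\<^sup>2 * (\<sigma>\<^sup>2 + b\<^sup>2) + 2 * h * \<kappa> * D * (\<sigma> + b)"
  have step: "\<alpha> * (\<integral>\<omega>. (norm (s k \<omega>))\<^sup>2 \<partial>M)
      \<le> (\<integral>\<omega>. (norm (z k \<omega> - zs))\<^sup>2 \<partial>M) - (\<integral>\<omega>. (norm (z (Suc k) \<omega> - zs))\<^sup>2 \<partial>M) + E" for k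
  proof -
    have "(\<integral>\<omega>. \<alpha> * (norm (s k \<omega>))\<^sup>2 \<partial>M) \<le> (\<integral>\<omega>. (norm (z k \<omega> - zs))\<^sup>2 - (norm (z (Suc k) \<omega> - zs))\<^sup>2
      + 4 * h\<^sup>2 * L * \<kappa> * ((noise (z k \<omega>) (uh k \<omega>))\<^sup>2 + (noise (zh k \<omega>) (u k \<omega>))\<^sup>2)
      + 4 * h * \<rho> * \<kappa>\<^sup>2 * ((noise (z k \<omega>) (uh k \<omega>))\<^sup>2 + b\<^sup>2)
      + 2 * h * \<kappa> * D * (noise (zh k \<omega>) (u k \<omega>) + b) \<partial>M)"
    proof (rule integral_mono)
      fix \<omega> assume \<omega>: "\<omega> \<in> space M"
      show "\<alpha> * (norm (s k \<omega>))\<^sup>2 \<le> (norm (z k \<omega> - zs))\<^sup>2 - (norm (z (Suc k) \<omega> - zs))\<^sup>2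
        + 4 * h\<^sup>2 * L * \<kappa> * ((noise (z k \<omega>) (uh k \<omega>))\<^sup>2 + (noise (zh k \<omega>) (u k \<omega>))\<^sup>2)
        + 4 * h * \<rho> * \<kappa>\<^sup>2 * ((noise (z k \<omega>) (uh k \<omega>))\<^sup>2 + b\<^sup>2)
        + 2 * h * \<kappa> * D * (noise (zh k \<omega>) (u k \<omega>) + b)"
        unfolding \<alpha>_def s[OF \<omega>] z_Suc[OF \<omega>] zh[OF \<omega>]
        by (intro extragradient_step h \<rho> zs minty z_in \<omega> proj_in)
    qed (intro Bochner_Integration.integrable_add Bochner_Integration.integrable_diff
        integrable_mult_right s_int z_int n1 n2 n2' M.integrable_const)+
    also have "\<dots> = (\<integral>\<omega>. (norm (z k \<omega> - zs))\<^sup>2 \<partial>M) - (\<integral>\<omega>. (norm (z (Suc k) \<omega> - zs))\<^sup>2 \<partial>M)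
      + 4 * h\<^sup>2 * L * \<kappa> * ((\<integral>\<omega>. (noise (z k \<omega>) (uh k \<omega>))\<^sup>2 \<partial>M) + (\<integral>\<omega>. (noise (zh k \<omega>) (u k \<omega>))\<^sup>2 \<partial>M))
      + 4 * h * \<rho> * \<kappa>\<^sup>2 * ((\<integral>\<omega>. (noise (z k \<omega>) (uh k \<omega>))\<^sup>2 \<partial>M) + b\<^sup>2)
      + 2 * h * \<kappa> * D * ((\<integral>\<omega>. noise (zh k \<omega>) (u k \<omega>) \<partial>M) + b)"
      using s_int z_int n1(1) n2(1) n2'(1) M.prob_space by simp
    also have "\<dots> \<le> (\<integral>\<omega>. (norm (z k \<omega> - zs))\<^sup>2 \<partial>M) - (\<integral>\<omega>. (norm (z (Suc k) \<omega> - zs))\<^sup>2 \<partial>M)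
      + 4 * h\<^sup>2 * L * \<kappa> * (\<sigma>\<^sup>2 + \<sigma>\<^sup>2) + 4 * h * \<rho> * \<kappa>\<^sup>2 * (\<sigma>\<^sup>2 + b\<^sup>2) + 2 * h * \<kappa> * D * (\<sigma> + b)"
      using h(1) \<rho> L_pos \<kappa>_ge_1 D_nonneg
      by (intro add_mono mult_left_mono n1 n2 n2' order_refl) auto
    finally show ?thesis by (simp add: E_def)
  qed
  have telescope: "\<alpha> * (\<Sum>k=0..n. \<integral>\<omega>. (norm (s k \<omega>))\<^sup>2 \<partial>M)
      \<le> (norm (z0 - zs))\<^sup>2 - (\<integral>\<omega>. (norm (z (Suc n) \<omega> - zs))\<^sup>2 \<partial>M) + (real n + 1) * E" for n
  proof (induction n)
    case 0
    have "(\<integral>\<omega>. (norm (z 0 \<omega> - zs))\<^sup>2 \<partial>M) = (\<integral>\<omega>. (norm (z0 - zs))\<^sup>2 \<partial>M)"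
      by (intro Bochner_Integration.integral_cong) (simp_all add: z_0)
    then show ?case using step[of 0] M.prob_space by simp
  next
    case (Suc n)
    then show ?case using step[of "Suc n"] by (simp add: algebra_simps)
  qed
  \<comment> \<open>The last squared distance left by the telescoping is dropped.\<close>
  have "0 \<le> (\<integral>\<omega>. (norm (z (Suc N) \<omega> - zs))\<^sup>2 \<partial>M)" by simp
  with telescope[of N] show ?thesis
    unfolding \<alpha>_def[symmetric] E_def[symmetric] by linarith
qed

end

subsection \<open>Block-diagonal matrices and the saddle operator\<close>

lemma sym_pos_def_inner:
  fixes B :: "real^'k^'k"
  assumes "sym_pos_def B"
  shows "(B *v x) \<bullet> y = x \<bullet> (B *v y)"
  using assms dot_lmul_matrix[of x B y] vector_transpose_matrix[of x B]
  by (metis sym_pos_def_def vector_transpose_matrix)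

lemma sym_pos_def_matrix_inv:
  fixes B :: "real^'k^'k"
  assumes "sym_pos_def B"
  shows "matrix_inv B *v (B *v x) = x" and "B *v (matrix_inv B *v x) = x"
proof -
  have "\<forall>x. B *v x = 0 \<longrightarrow> x = 0"
    using assms unfolding sym_pos_def_def by (metis inner_zero_right less_irrefl)
  then have "invertible B"
    using matrix_left_invertible_ker[of B] invertible_left_inverse[of B] by blast
  then have "B ** matrix_inv B = mat 1 \<and> matrix_inv B ** B = mat 1"
    unfolding invertible_def matrix_inv_def by (rule someI_ex)
  then show "matrix_inv B *v (B *v x) = x" "B *v (matrix_inv B *v x) = x"
    by (simp_all add: matrix_vector_mul_assoc)
qed

lemma pos_def_operator_blockdiag:
  fixes B1 :: "real^'n^'n" and B2 :: "real^'m^'m"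
  assumes "sym_pos_def B1" and "sym_pos_def B2"
  shows "pos_def_operator (blockdiag B1 B2)"
proof
  fix v w :: "(real^'n) \<times> (real^'m)" and r :: real
  show "blockdiag B1 B2 (v + w) = blockdiag B1 B2 v + blockdiag B1 B2 w"
    by (simp add: blockdiag_def matrix_vector_right_distrib)
  show "blockdiag B1 B2 (r *\<^sub>R v) = r *\<^sub>R blockdiag B1 B2 v"
    by (simp add: blockdiag_def matrix_vector_mult_scaleR scaleR_prod_def)
  show "blockdiag B1 B2 v \<bullet> w = v \<bullet> blockdiag B1 B2 w"
    using assms by (simp add: blockdiag_def inner_prod_def sym_pos_def_inner)
  assume v: "v \<noteq> 0"
  have *: "0 \<le> fst v \<bullet> (B1 *v fst v)" "0 \<le> snd v \<bullet> (B2 *v snd v)"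
    using assms unfolding sym_pos_def_def by (metis inner_zero_left order_le_less)+
  have "fst v \<noteq> 0 \<or> snd v \<noteq> 0" using v by (auto simp: prod_eq_iff)
  then have "0 < fst v \<bullet> (B1 *v fst v) \<or> 0 < snd v \<bullet> (B2 *v snd v)"
    using assms unfolding sym_pos_def_def by blast
  then show "0 < v \<bullet> blockdiag B1 B2 v" using * by (auto simp: blockdiag_def inner_prod_def)
qed

lemma pos_def_pair_blockdiag:
  fixes B1 :: "real^'n^'n" and B2 :: "real^'m^'m"
  assumes "sym_pos_def B1" and "sym_pos_def B2"
  shows "pos_def_pair (blockdiag B1 B2) (blockdiag (matrix_inv B1) (matrix_inv B2))
    (Min (eigenvalues (blockdiag B1 B2))) (Max (eigenvalues (blockdiag B1 B2)))"
proof -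
  interpret pos_def_operator "blockdiag B1 B2" by (rule pos_def_operator_blockdiag[OF assms])
  show ?thesis
  proof
    show "blockdiag (matrix_inv B1) (matrix_inv B2) (blockdiag B1 B2 v) = v"
      "blockdiag B1 B2 (blockdiag (matrix_inv B1) (matrix_inv B2) v) = v" for v
      using assms by (simp_all add: blockdiag_def sym_pos_def_matrix_inv)
    obtain v where v: "v \<noteq> 0" "blockdiag B1 B2 v = Min (eigenvalues (blockdiag B1 B2)) *\<^sub>R v"
      using Min_eigenvalue_bound(2)[OF lin sym] by (auto simp: eigenvalues_def)
    then show "0 < Min (eigenvalues (blockdiag B1 B2))"
      using pos[OF v(1)] by (simp add: zero_less_mult_iff) (metis inner_ge_zero not_less)
  qed (intro Min_eigenvalue_bound Max_eigenvalue_bound lin sym)+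
qed

section \<open>Gradients and the saddle operator\<close>

lemma GDERIV_unique:
  assumes "GDERIV f z :> D" and "GDERIV f z :> D'"
  shows "D = D'"
proof -
  have "(\<lambda>h. h \<bullet> D) = (\<lambda>h. h \<bullet> D')"
    using assms unfolding gderiv_def by (rule has_derivative_unique)
  then have "h \<bullet> (D - D') = 0" for h by (metis eq_iff_diff_eq_0 inner_diff_right)
  then show ?thesis by (metis inner_eq_zero_iff eq_iff_diff_eq_0)
qed

lemma grad_eqI: "GDERIV f z :> D \<Longrightarrow> grad f z = D"
  unfolding grad_def using GDERIV_unique by blast

text \<open>The derivative is a linear functional, represented in coordinates by its values on the
  basis. Uniqueness identifies this vector with the description in \<open>grad\<close>.\<close>

lemma GDERIV_grad:
  fixes f :: "'a::euclidean_space \<Rightarrow> real"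
  assumes "f differentiable (at z)"
  shows "GDERIV f z :> grad f z"
proof -
  obtain F where F: "(f has_derivative F) (at z)" using assms by (auto simp: differentiable_def)
  interpret F: linear F using F by (rule has_derivative_linear)
  have "F h = h \<bullet> (\<Sum>b\<in>Basis. F b *\<^sub>R b)" for h
  proof -
    have "F h = F (\<Sum>b\<in>Basis. (h \<bullet> b) *\<^sub>R b)" by (simp add: euclidean_representation)
    then show ?thesis by (simp add: F.sum F.scale inner_sum_right mult.commute)
  qed
  then have "F = (\<lambda>h. h \<bullet> (\<Sum>b\<in>Basis. F b *\<^sub>R b))" by blast
  with F have "GDERIV f z :> (\<Sum>b\<in>Basis. F b *\<^sub>R b)" unfolding gderiv_def by metis
  with grad_eqI[OF this] show ?thesis by simp
qed

definition flip_snd :: "'a \<times> 'b::uminus \<Rightarrow> 'a \<times> 'b" where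
  "flip_snd z = (fst z, - snd z)"

text \<open>The chain rule along the two coordinate embeddings shows that the partial gradients are
  the blocks of the full one. This serves both \<open>f\<close> and its smoothing.\<close>

lemma saddle_op_eq:
  assumes "GDERIV f z :> D"
  shows "saddle_op f z = flip_snd D"
proof -
  have f: "(f has_derivative (\<lambda>h. h \<bullet> D)) (at (fst z, snd z))" using assms by (simp add: gderiv_def)
  have "((\<lambda>x. (x, snd z)) has_derivative (\<lambda>h. (h, 0))) (at (fst z))"
    by (intro derivative_eq_intros) auto
  from has_derivative_compose[OF this f]
  have "GDERIV (\<lambda>x. f (x, snd z)) (fst z) :> fst D"
    by (simp add: gderiv_def inner_prod_def)
  moreover have "((\<lambda>y. (fst z, y)) has_derivative (\<lambda>h. (0, h))) (at (snd z))"
    by (intro derivative_eq_intros) auto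
  from has_derivative_compose[OF this f]
  have "GDERIV (\<lambda>y. f (fst z, y)) (snd z) :> snd D"
    by (simp add: gderiv_def inner_prod_def)
  ultimately show ?thesis by (simp add: saddle_op_def flip_snd_def grad_eqI)
qed

text \<open>Compactness of \<open>Z \<times> Z\<close> bounds the set of distances, so that its
  \<open>Sup\<close> is an upper bound.\<close>

lemma diameterB_upper:
  assumes B: "sym_pos_def B1" "sym_pos_def B2" and Z: "compact Z" "v \<in> Z" "w \<in> Z"
  shows "normB B1 B2 (v - w) \<le> diameterB B1 B2 Z"
  unfolding diameterB_def
proof (rule cSup_upper)
  interpret pos_def_operator "blockdiag B1 B2" by (rule pos_def_operator_blockdiag[OF B])
  have norm_eq: "normB B1 B2 = opnorm (blockdiag B1 B2)" by (simp add: fun_eq_iff normB_def opnorm_def)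
  have "compact ((\<lambda>x. opnorm (blockdiag B1 B2) (fst x - snd x)) ` (Z \<times> Z))"
    by (intro compact_continuous_image continuous_intros compact_Times Z(1))
  then have "bdd_above ((\<lambda>x. opnorm (blockdiag B1 B2) (fst x - snd x)) ` (Z \<times> Z))"
    by (intro bounded_imp_bdd_above compact_imp_bounded)
  then show "bdd_above {normB B1 B2 (z1 - z2) | z1 z2. z1 \<in> Z \<and> z2 \<in> Z}"
    by (rule bdd_above_mono) (force simp: norm_eq)
qed (use Z in blast)

text \<open>\<open>ennreal\<close> truncates negative values to zero, so a negative constant would
  give the zero measure. The sign of the determinants is thus never examined.\<close>

lemma normalized_exponential_nonneg:
  assumes "prob_space (density lborel (\<lambda>u. ennreal (c * exp (q u))))"
  shows "0 \<le> c"
proof (rule ccontr)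
  assume "\<not> 0 \<le> c"
  then have "(\<lambda>u. ennreal (c * exp (q u))) = (\<lambda>u. 0)"
    by (auto simp: fun_eq_iff ennreal_neg mult_le_0_iff)
  then have "emeasure (density lborel (\<lambda>u. ennreal (c * exp (q u)))) UNIV = 0"
    by (simp add: emeasure_density)
  then show False using prob_space.emeasure_space_1[OF assms] by simp
qed

text \<open>Every term carries a factor \<open>q\<close> or \<open>q\<^sup>2\<close> with
  \<open>q = 2 * L1 * \<kappa> * L * h\<close> in the unit interval, and these factors are dropped.
  One noise coefficient is also enlarged from 4 to 36.\<close>

lemma rate_constants:
  fixes l L \<kappa> L1 h \<rho> \<sigma> D b \<beta> :: real
  assumes pos: "0 < l" "0 < L" "0 < \<kappa>" "0 < L1" and h: "0 < h" "h \<le> 1 / (2 * L1 * \<kappa> * L)"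
    and nonneg: "0 \<le> \<rho>" "0 \<le> \<sigma>" "0 \<le> D" "0 \<le> \<beta>" and b: "b = \<beta> / 2"
  shows "2 * L1 * l * L * \<kappa> * (8 * h\<^sup>2 * L * \<kappa> * \<sigma>\<^sup>2 + 4 * h * \<rho> * \<kappa>\<^sup>2 * (\<sigma>\<^sup>2 + b\<^sup>2) + 2 * h * \<kappa> * D * (\<sigma> + b))
    \<le> D * l * \<kappa> * \<beta> + \<rho> * l * \<kappa>\<^sup>2 * \<beta>\<^sup>2 + (36 * \<rho> * \<kappa>\<^sup>2 * l + 4 * l / L1) * \<sigma>\<^sup>2 + 2 * D * l * \<kappa> * \<sigma>"
proof -
  define q where "q = 2 * L1 * \<kappa> * L * h"
  have q: "0 \<le> q" "q \<le> 1" using pos h by (simp_all add: q_def field_simps)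
  have "2 * L1 * l * L * \<kappa> * (8 * h\<^sup>2 * L * \<kappa> * \<sigma>\<^sup>2 + 4 * h * \<rho> * \<kappa>\<^sup>2 * (\<sigma>\<^sup>2 + b\<^sup>2) + 2 * h * \<kappa> * D * (\<sigma> + b))
    = q * (D * l * \<kappa> * \<beta>) + q * (\<rho> * l * \<kappa>\<^sup>2 * \<beta>\<^sup>2) + (q * (4 * \<rho> * \<kappa>\<^sup>2 * l) + q\<^sup>2 * (4 * l / L1)) * \<sigma>\<^sup>2
      + q * (2 * D * l * \<kappa> * \<sigma>)"
    using pos by (simp add: q_def b power2_eq_square field_simps)
  also have "\<dots> \<le> 1 * (D * l * \<kappa> * \<beta>) + 1 * (\<rho> * l * \<kappa>\<^sup>2 * \<beta>\<^sup>2)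
      + (1 * (36 * \<rho> * \<kappa>\<^sup>2 * l) + 1 * (4 * l / L1)) * \<sigma>\<^sup>2 + 1 * (2 * D * l * \<kappa> * \<sigma>)"
    using pos nonneg q power_le_one[OF q, of 2] by (intro add_mono mult_mono) auto
  finally show ?thesis by simp
qed

section \<open>Specialisation to block-diagonal matrices and the final rate\<close>

theorem theorem3:
  fixes f :: "(real^'n) \<times> (real^'m) \<Rightarrow> real"
    and B1 :: "real^'n^'n" and B2 :: "real^'m^'m"
    and X :: "(real^'n) set" and Y :: "(real^'m) set"
    and Z :: "((real^'n) \<times> (real^'m)) set"
    and L1 \<mu> \<sigma> \<rho> h lmin lmax \<kappa> Dz d :: real
    and zstar z0 :: "(real^'n) \<times> (real^'m)"
    and M :: "'w measure"
    and uhat u z zhat s :: "nat \<Rightarrow> 'w \<Rightarrow> (real^'n) \<times> (real^'m)"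
    and N :: nat
  assumes "sym_pos_def B1" and "sym_pos_def B2"
    and "lmin = Min (eigenvalues (blockdiag B1 B2))"
    and "lmax = Max (eigenvalues (blockdiag B1 B2))"
    and "\<kappa> = lmax / lmin"
    and "d = real (CARD('n) + CARD('m))"
    and "cont_diff f"
    and "L1 > 0"
    and "\<forall>z1 z2. dual_normB B1 B2 (grad f z1 - grad f z2) \<le> L1 * normB B1 B2 (z1 - z2)"
    and "Z = X \<times> Y" and "Z \<noteq> {}" and "compact Z" and "convex Z"
    and "Dz = diameterB B1 B2 Z"
    and "\<mu> > 0" and "\<sigma> \<ge> 0"
    and "\<forall>w. (LINT v|gauss_measure B1 B2.
           (dual_normB B1 B2 (zo_oracle B1 B2 \<mu> f w v - saddle_op (smoothing B1 B2 \<mu> f) w))\<^sup>2) \<le> \<sigma>\<^sup>2"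
    and "0 \<le> \<rho>" and "\<rho> < 1 / (24 * L1 * \<kappa>\<^sup>2)"
    and "zstar \<in> Z"
    and "\<forall>w\<in>Z. \<forall>wbar\<in>Z. \<forall>a>0.
           prox_residual B1 B2 Z w a (saddle_op f wbar) \<bullet> (wbar - zstar)
           + \<rho> / 2 * (dual_normB B1 B2 (prox_residual B1 B2 Z w a (saddle_op f wbar)))\<^sup>2 \<ge> 0"
    and "h > 0"
    and "sqrt (6 * \<rho> / (L1 * \<kappa> * lmax * lmin)) < h" and "h \<le> 1 / (2 * L1 * \<kappa> * lmax)"
    and "z0 \<in> Z"
    and "gaussian_samples M B1 B2 uhat u"
    and "\<forall>\<omega>\<in>space M. zo_eg B1 B2 \<mu> f Z (\<lambda>_. h) (\<lambda>_. h) z0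
           (\<lambda>k. uhat k \<omega>) (\<lambda>k. u k \<omega>) (\<lambda>k. z k \<omega>) (\<lambda>k. zhat k \<omega>)"
    and "\<forall>k. \<forall>\<omega>\<in>space M.
           s k \<omega> = prox_residual B1 B2 Z (z k \<omega>) h (zo_oracle B1 B2 \<mu> f (z k \<omega>) (uhat k \<omega>))"
  shows "1 / (real N + 1) * (\<Sum>k=0..N. prob_space.expectation M (\<lambda>\<omega>. (norm (s k \<omega>))\<^sup>2))
    \<le> 2 * L1 * lmin * lmax * \<kappa> * (norm (z0 - zstar))\<^sup>2
        / ((L1 * h\<^sup>2 * lmin * lmax * \<kappa> - 6 * \<rho>) * (real N + 1))
      + \<mu> * Dz * lmin * \<kappa> * L1 * (d + 3) powr (3 / 2)
        / (L1 * h\<^sup>2 * lmin * lmax * \<kappa> - 6 * \<rho>)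
      + \<mu>\<^sup>2 * \<rho> * lmin * \<kappa>\<^sup>2 * L1\<^sup>2 * (d + 3) ^ 3
        / (L1 * h\<^sup>2 * lmin * lmax * \<kappa> - 6 * \<rho>)
      + (36 * \<rho> * \<kappa>\<^sup>2 * lmin + 4 * lmin / L1) * \<sigma>\<^sup>2
        / (L1 * h\<^sup>2 * lmin * lmax * \<kappa> - 6 * \<rho>)
      + 2 * Dz * lmin * \<kappa> * \<sigma>
        / (L1 * h\<^sup>2 * lmin * lmax * \<kappa> - 6 * \<rho>)"
proof -
  define T where "T = blockdiag B1 B2"
  define A where "A = blockdiag (matrix_inv B1) (matrix_inv B2)"
  define c where "c = sqrt (det B1 * det B2) / (2 * pi) powr (real (CARD('n) + CARD('m)) / 2)"
  note B = assms(1,2)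
  have opnorms: "normB B1 B2 = opnorm T" "dual_normB B1 B2 = opnorm A"
    by (simp_all add: fun_eq_iff normB_def dual_normB_def opnorm_def T_def A_def)
  have projs: "projB B1 B2 Z = op_proj T Z" "prox_residual B1 B2 Z = op_residual T Z"
    by (simp_all add: fun_eq_iff projB_def op_proj_def prox_residual_def op_residual_def opnorms)
  have gauss_eq: "gauss_measure B1 B2 = density lborel (\<lambda>u. ennreal (c * exp (- (u \<bullet> T u) / 2)))"
    by (simp add: gauss_measure_def gauss_density_def c_def T_def)
  have M: "prob_space M" and indep: "prob_space.indep_vars M (\<lambda>_. borel) (case_sum uhat u) UNIV"
    and dist: "\<And>k. distributed M lborel (uhat k) (\<lambda>v. ennreal (gauss_density B1 B2 v))"
      "\<And>k. distributed M lborel (u k) (\<lambda>v. ennreal (gauss_density B1 B2 v))"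
    using \<open>gaussian_samples M B1 B2 uhat u\<close> by (simp_all add: gaussian_samples_def)
  have law: "distr M borel (uhat k) = gauss_measure B1 B2" "distr M borel (u k) = gauss_measure B1 B2" for k
    using dist[of k, THEN distributed_distr_eq_density]
    by (simp_all add: gauss_measure_def cong: distr_cong)
  \<comment> \<open>Normalisation of the density is read off from the law of a sample instead of
    computing a Gaussian integral.\<close>
  have prob: "prob_space (density lborel (\<lambda>u. ennreal (c * exp (- (u \<bullet> T u) / 2))))"
    unfolding gauss_eq[symmetric] law(1)[of 0, symmetric]
    using dist(1)[of 0] by (intro prob_space.prob_space_distr M) (simp add: distributed_def)

  have bounds: "pos_def_pair T A lmin lmax"
    using pos_def_pair_blockdiag[OF B] assms(3,4) by (simp add: T_def A_def)
  interpret P: pos_def_pair T A lmin lmax by (rule bounds)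
  have c: "0 \<le> c" by (rule normalized_exponential_nonneg[OF prob])
  interpret P: gaussian_pair T A lmin lmax c
    by (intro gaussian_pair.intro gaussian_pair_axioms.intro bounds c prob)
  interpret P: smooth_objective T A lmin lmax c f "grad f" L1 \<mu>
  proof unfold_locales
    show "GDERIV f z :> grad f z" for z
      using \<open>cont_diff f\<close> unfolding cont_diff_def by (intro GDERIV_grad) blast
    show "opnorm A (grad f v - grad f w) \<le> L1 * opnorm T (v - w)" for v w
      using assms(9) by (simp only: opnorms)
  qed fact+
  have gauss: "gauss_measure B1 B2 = P.gauss" by (simp add: P.gauss_def gauss_eq)
  \<comment> \<open>Twice the bias bound; its first and second powers give the two smoothing terms
    of the rate.\<close>
  define \<beta> where "\<beta> = \<mu> * L1 * (d + 3) powr (3 / 2)"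
  interpret P: saddle_problem T A lmin lmax c f "grad f" L1 \<mu> flip_snd Z \<kappa> Dz "\<beta> / 2"
  proof unfold_locales
    show "flip_snd (v + w) = flip_snd v + flip_snd w" for v w :: "(real^'n) \<times> (real^'m)"
      by (simp add: flip_snd_def)
    show "flip_snd (r *\<^sub>R v) = r *\<^sub>R flip_snd v" for r and v :: "(real^'n) \<times> (real^'m)"
      by (simp add: flip_snd_def scaleR_prod_def)
    show "norm (flip_snd v) = norm v" for v :: "(real^'n) \<times> (real^'m)"
      by (simp add: flip_snd_def norm_prod_def)
    show "opnorm A (flip_snd v) = opnorm A v" for v
      by (simp add: flip_snd_def opnorm_def A_def blockdiag_def inner_prod_def
          linear_neg[OF matrix_vector_mul_linear])
    show "opnorm T (v - w) \<le> Dz" if "v \<in> Z" "w \<in> Z" for v w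
      using diameterB_upper[OF B \<open>compact Z\<close> that] \<open>Dz = diameterB B1 B2 Z\<close> by (simp only: opnorms)
    show "opnorm A (P.smooth_g v - grad f v) \<le> \<beta> / 2" for v
      using P.smooth_g_bias[of v] by (simp add: \<beta>_def assms(6))
  qed fact+
  have F: "saddle_op f w = flip_snd (grad f w)" for w by (rule saddle_op_eq[OF P.grad])
  have "smoothing B1 B2 \<mu> f = P.smooth_f"
    by (simp add: fun_eq_iff smoothing_def P.smooth_f_def gauss)
  then have Fs: "saddle_op (smoothing B1 B2 \<mu> f) w = flip_snd (P.smooth_g w)" for w
    using saddle_op_eq[OF P.GDERIV_smooth] by simp
  have G: "zo_oracle B1 B2 \<mu> f = P.estimator"
    by (intro ext, unfold zo_oracle_def P.estimator_def) (simp add: T_def blockdiag_def flip_snd_def)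
  have iterates: "z 0 \<omega> = z0" "zhat k \<omega> = op_proj T Z (z k \<omega> - h *\<^sub>R P.estimator (z k \<omega>) (uhat k \<omega>))"
    "z (Suc k) \<omega> = op_proj T Z (z k \<omega> - h *\<^sub>R P.estimator (zhat k \<omega>) (u k \<omega>))"
    "s k \<omega> = op_residual T Z (z k \<omega>) h (P.estimator (z k \<omega>) (uhat k \<omega>))"
    if "\<omega> \<in> space M" for k \<omega>
    using assms(27,28) that by (simp_all only: zo_eg_def projs G)

  define S where "S = (\<Sum>k=0..N. \<integral>\<omega>. (norm (s k \<omega>))\<^sup>2 \<partial>M)"
  define V where "V = (norm (z0 - zstar))\<^sup>2"
  define E where "E = 8 * h\<^sup>2 * lmax * \<kappa> * \<sigma>\<^sup>2 + 4 * h * \<rho> * \<kappa>\<^sup>2 * (\<sigma>\<^sup>2 + (\<beta> / 2)\<^sup>2) + 2 * h * \<kappa> * Dz * (\<sigma> + \<beta> / 2)"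
  \<comment> \<open>Multiplying by \<open>K\<close> clears denominators: the left coefficient of the
    expectation bound is \<open>\<Delta> / K\<close>.\<close>
  define K where "K = 2 * L1 * lmin * lmax * \<kappa>"
  define \<Delta> where "\<Delta> = L1 * h\<^sup>2 * lmin * lmax * \<kappa> - 6 * \<rho>"
  have h: "0 < h" "h \<le> 1 / (2 * L1 * \<kappa> * lmax)" by fact+
  have "(h\<^sup>2 / 2 - 3 * \<rho> / (L1 * lmin * lmax * \<kappa>)) * S \<le> V + (real N + 1) * E"
    unfolding S_def V_def E_def
  proof (rule P.extragradient_expectation_bound[OF M indep])
    show "distr M borel (uhat k) = P.gauss" "distr M borel (u k) = P.gauss" for k
      by (simp_all add: law gauss)
    show "(\<integral>v. (P.noise w v)\<^sup>2 \<partial>P.gauss) \<le> \<sigma>\<^sup>2" for w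
      using assms(17) by (simp only: P.noise_def Fs G opnorms gauss)
    show "0 \<le> op_residual T Z w h (flip_snd (grad f v)) \<bullet> (v - zstar)
        + \<rho> / 2 * (opnorm A (op_residual T Z w h (flip_snd (grad f v))))\<^sup>2"
      if "w \<in> Z" "v \<in> Z" for w v
      using assms(21) that h(1) by (simp only: opnorms projs F)
  qed (assumption | rule iterates | fact)+
  moreover have \<kappa>: "0 < \<kappa>" using P.\<kappa>_ge_1 by simp
  then have K: "0 < K" using P.l_pos P.L_pos P.L1_pos by (simp add: K_def)
  moreover have "h\<^sup>2 / 2 - 3 * \<rho> / (L1 * lmin * lmax * \<kappa>) = \<Delta> / K"
    using P.l_pos P.L_pos P.L1_pos \<kappa> by (simp add: \<Delta>_def K_def field_simps)
  ultimately have "K * (\<Delta> / K * S) \<le> K * (V + (real N + 1) * E)"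
    by (intro mult_left_mono) simp_all
  then have main: "\<Delta> * S \<le> K * V + (real N + 1) * (K * E)"
    using K by (simp add: algebra_simps)
  \<comment> \<open>Squaring the lower bound on the step size is exactly positivity of
    \<open>\<Delta>\<close>.\<close>
  have "6 * \<rho> / (L1 * \<kappa> * lmax * lmin) < h\<^sup>2"
    using \<open>sqrt (6 * \<rho> / (L1 * \<kappa> * lmax * lmin)) < h\<close> real_le_rsqrt[of h] by (meson not_less)
  then have \<Delta>: "0 < \<Delta>"
    using P.l_pos P.L_pos P.L1_pos \<kappa> by (simp add: \<Delta>_def field_simps)
  define R where "R = Dz * lmin * \<kappa> * \<beta> + \<rho> * lmin * \<kappa>\<^sup>2 * \<beta>\<^sup>2
    + (36 * \<rho> * \<kappa>\<^sup>2 * lmin + 4 * lmin / L1) * \<sigma>\<^sup>2 + 2 * Dz * lmin * \<kappa> * \<sigma>"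
  have "0 \<le> \<beta>" using P.b_nonneg by simp
  then have "K * E \<le> R"
    unfolding K_def E_def R_def
    by (intro rate_constants P.l_pos P.L_pos P.L1_pos \<kappa> h P.D_nonneg assms(16,18)) simp_all
  then have "(real N + 1) * (K * E) \<le> (real N + 1) * R" by (intro mult_left_mono) auto
  with main have total: "\<Delta> * S \<le> K * V + (real N + 1) * R" by linarith
  define n where "n = real N + 1"
  have n: "0 < n" by (simp add: n_def)
  have "1 / n * S = \<Delta> * S / (\<Delta> * n)" using \<Delta> by simp
  also have "\<dots> \<le> (K * V + n * R) / (\<Delta> * n)"
    using total \<Delta> n by (intro divide_right_mono) (simp_all add: n_def)
  also have "\<dots> = K * V / (\<Delta> * n) + R / \<Delta>"
    using \<Delta> n by (simp add: add_divide_distrib)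
  also have "R / \<Delta> = \<mu> * Dz * lmin * \<kappa> * L1 * (d + 3) powr (3 / 2) / \<Delta>
      + \<mu>\<^sup>2 * \<rho> * lmin * \<kappa>\<^sup>2 * L1\<^sup>2 * (d + 3) ^ 3 / \<Delta>
      + (36 * \<rho> * \<kappa>\<^sup>2 * lmin + 4 * lmin / L1) * \<sigma>\<^sup>2 / \<Delta> + 2 * Dz * lmin * \<kappa> * \<sigma> / \<Delta>"
  proof -
    have "0 < d + 3" using assms(6) by (simp add: add_nonneg_pos)
    then have "((d + 3) powr (3 / 2))\<^sup>2 = (d + 3) ^ 3"
      using powr_realpow[of "d + 3" 3] by (simp add: power2_eq_square flip: powr_add)
    then have "\<beta>\<^sup>2 = \<mu>\<^sup>2 * L1\<^sup>2 * (d + 3) ^ 3" by (simp add: \<beta>_def power_mult_distrib)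
    then show ?thesis by (simp add: R_def \<beta>_def add_divide_distrib ac_simps)
  qed
  finally show ?thesis unfolding S_def V_def K_def \<Delta>_def n_def by (simp only: add.assoc)
qed

end
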